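(* Let $d\ge 2$ and let $A\subset\mathbb{R}^d$ be a bounded set such that $\dim_B(A)$ is well defined (i.e. the limit defining it exists), and such that $$0<\liminf_{\delta\to 0}\delta^{\dim_B(A)}N_\delta(A)\le\limsup_{\delta\to 0}\delta^{\dim_B(A)}N_\delta(A)<\infty .$$ Then the sequence of random variables $$\bigl(\mathcal{T}(nA)-\dim_B(A)(\log n+\log\log n)\bigr)_{n\ge 2}$$ is tight, where $nA=\{nx:x\in A\}$.
   Context: Fix $d\ge 2$. Let $A(d,1)$ be the set of all (infinite) lines in $\mathbb{R}^d$, and let $B(x,\rho)$ be the closed ball of radius $\rho$ centred at $x$; $o$ is the origin. Let $\mu_{d,1}$ be the unique (locally finite Borel) measure on $A(d,1)$ invariant under rotations, reflections and translations, normalized so that $\mu_{d,1}(\{L\in A(d,1):L\cap B(o,1)\ne\emptyset\})=1$. Let $\Psi$ be a Poisson point process on $A(d,1)\times\mathbb{R}^+$ with intensity measure $\mu_{d,1}\times\lambda_1^+$, where $\lambda_1^+$ is Lebesgue measure on $\mathbb{R}^+$. For a line $L$ let $\mathfrak{c}(L)=\{x\in\mathbb{R}^d:d(x,L)\le 1\}$ be the cylinder of radius $1$ around $L$ ($d(\cdot,\cdot)$ is Euclidean distance). The cover time of a set $A\subset\mathbb{R}^d$ is $$\mathcal{T}(A)=\inf\Bigl\{t>0:A\subset\bigcup_{(L,s)\in\Psi:\,s\le t}\mathfrak{c}(L)\Bigr\}.$$ For bounded $A\subset\mathbb{R}^d$ and $\delta>0$, $N_\delta(A)$ is the minimum number of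 boxes of side length $\delta$ needed to cover $A$, and the box dimension is $\dim_B(A)=\lim_{\delta\to0}\frac{\log N_\delta(A)}{-\log\delta}$ whenever this limit exists. *)

theory Defs
  imports "HOL-Probability.Probability"
begin

section \<open>The space of lines and its invariant measure\<close>

definition lines :: "'a::euclidean_space set set" where
  "lines = {L. affine L \<and> aff_dim L = 1}"

text \<open>The usual topology on the affine Grassmannian of lines: the quotient topology for the
  parametrisation of lines by a point and a nonzero direction vector.\<close>

definition open_line_sets :: "'a::euclidean_space set set set" where
  "open_line_sets =
     {U. U \<subseteq> lines \<and> open {(x, v). v \<noteq> 0 \<and> range (\<lambda>t::real. x + t *\<^sub>R v) \<in> U}}"

definition line_borel :: "'a::euclidean_space set measure" where
  "line_borel = sigma lines open_line_sets"

text \<open>Rotations and reflections are the orthogonal transformations.\<close>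

definition invariant_line_measure :: "'a::euclidean_space set measure \<Rightarrow> bool" where
  "invariant_line_measure \<mu> \<longleftrightarrow>
     sets \<mu> = sets line_borel \<and>
     (\<forall>L\<in>lines. \<exists>U\<in>open_line_sets. L \<in> U \<and> emeasure \<mu> U < \<infinity>) \<and>
     (\<forall>f. orthogonal_transformation f \<longrightarrow> distr \<mu> \<mu> ((`) f) = \<mu>) \<and>
     (\<forall>a. distr \<mu> \<mu> ((`) ((+) a)) = \<mu>) \<and>
     emeasure \<mu> {L \<in> lines. L \<inter> cball 0 1 \<noteq> {}} = 1"

section \<open>Poisson point processes\<close>

text \<open>A configuration is a set of points, counted without multiplicity; this loses nothing
  for a diffuse intensity measure.\<close>

definition num_points :: "('w \<Rightarrow> 'x set) \<Rightarrow> 'x set \<Rightarrow> 'w \<Rightarrow> ennreal" where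
  "num_points \<Psi> B \<omega> = emeasure (count_space UNIV) (\<Psi> \<omega> \<inter> B)"

definition poisson_point_process :: "'w measure \<Rightarrow> 'x measure \<Rightarrow> ('w \<Rightarrow> 'x set) \<Rightarrow> bool" where
  "poisson_point_process P \<Lambda> \<Psi> \<longleftrightarrow>
     prob_space P \<and>
     (\<forall>\<omega>\<in>space P. \<Psi> \<omega> \<subseteq> space \<Lambda>) \<and>
     (\<forall>B\<in>sets \<Lambda>. num_points \<Psi> B \<in> borel_measurable P) \<and>
     (\<forall>B\<in>sets \<Lambda>. emeasure \<Lambda> B < \<infinity> \<longrightarrow>
        (\<forall>k::nat. measure P {\<omega> \<in> space P. num_points \<Psi> B \<omega> = of_nat k}
           = measure \<Lambda> B ^ k / fact k * exp (- measure \<Lambda> B))) \<and>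
     (\<forall>B\<in>sets \<Lambda>. emeasure \<Lambda> B = \<infinity> \<longrightarrow> (AE \<omega> in P. num_points \<Psi> B \<omega> = \<infinity>)) \<and>
     (\<forall>B::nat \<Rightarrow> 'x set. range B \<subseteq> sets \<Lambda> \<and> disjoint_family B \<longrightarrow>
        prob_space.indep_vars P (\<lambda>_. borel) (\<lambda>i. num_points \<Psi> (B i)) UNIV)"

text \<open>Local finiteness on the product of the line space with the half-line: a set of pairs
  is relatively compact iff its lines meet a common ball and its times are bounded.\<close>

definition locally_finite_lines :: "('a::euclidean_space set \<times> real) set \<Rightarrow> bool" where
  "locally_finite_lines \<psi> \<longleftrightarrow>
     (\<forall>r t. finite {(L, s). (L, s) \<in> \<psi> \<and> L \<inter> cball 0 r \<noteq> {} \<and> s \<le> t})"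

definition poisson_line_process ::
  "'w measure \<Rightarrow> 'a::euclidean_space set measure \<Rightarrow> ('w \<Rightarrow> ('a set \<times> real) set) \<Rightarrow> bool" where
  "poisson_line_process P \<mu> \<Psi> \<longleftrightarrow>
     poisson_point_process P (\<mu> \<Otimes>\<^sub>M restrict_space lborel {0..}) \<Psi> \<and>
     (\<forall>\<omega>\<in>space P. locally_finite_lines (\<Psi> \<omega>))"

section \<open>Cover times\<close>

definition cylinder :: "'a::euclidean_space set \<Rightarrow> 'a set" where
  "cylinder L = {x. infdist x L \<le> 1}"

text \<open>Extended-real valued, so that the cover time is infinite if the set is never covered.\<close>

definition cover_time :: "('a::euclidean_space set \<times> real) set \<Rightarrow> 'a set \<Rightarrow> ereal" where
  "cover_time \<psi> A =
     Inf {ereal t | t. t > 0 \<and> A \<subseteq> (\<Union>(L, s)\<in>{(L, s). (L, s) \<in> \<psi> \<and> s \<le> t}. cylinder L)}"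

section \<open>Box dimension\<close>

definition box_count :: "real \<Rightarrow> 'a::euclidean_space set \<Rightarrow> nat" where
  "box_count \<delta> A =
     (LEAST k. \<exists>S. finite S \<and> card S = k \<and> A \<subseteq> (\<Union>a\<in>S. cbox a (a + \<delta> *\<^sub>R One)))"

definition has_box_dim :: "'a::euclidean_space set \<Rightarrow> real \<Rightarrow> bool" where
  "has_box_dim A D \<longleftrightarrow>
     ((\<lambda>\<delta>. ln (real (box_count \<delta> A)) / (- ln \<delta>)) \<longlongrightarrow> D) (at_right 0)"

definition box_dim :: "'a::euclidean_space set \<Rightarrow> real" where
  "box_dim A = (THE D. has_box_dim A D)"

end

theory Submission
  imports Defs "HOL-Real_Asymp.Real_Asymp"
begin

text \<open>
  A fixed point is uncovered at time \<open>t\<close> with probability \<open>exp (- t)\<close>. For the upper tail, cover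
  \<open>n A\<close> by about \<open>(n ln n) powr D\<close> balls of radius \<open>\<epsilon> \<approx> 1 / ln n\<close>; a ball is covered by a single
  cylinder with intensity at least \<open>1 - C \<epsilon>\<close>, and \<open>\<epsilon> t\<close> stays bounded at the relevant times, so a
  union bound suffices. For the lower tail, take about \<open>(n ln n) powr D\<close> points of \<open>n A\<close> at
  mutual distance at least \<open>1 / ln n\<close> and apply Chebyshev's inequality to the number of uncovered ones.
  The number of pairs at a given distance is bounded by a volume argument only, since \<open>A\<close> may be very
  inhomogeneous; this is enough because the measure of the lines hitting two unit balls at distance
  \<open>s\<close> is at most \<open>1 - c min s 1\<close> and at most \<open>C / s\<close>.

  All estimates on the line measure are derived from its invariance by disjointness and
  telescoping arguments, without an explicit formula for the measure.
\<close>

section \<open>The space of lines\<close>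

text \<open>The scale 1 / ln n is set by the correlations. For r at most 1, two points at distance r
  are both uncovered at time t with probability at most exp (- t - c t r), so uncovered points
  cluster at scale 1 / t, and t is of order ln n. Thus n A offers about (n ln n) powr D separate
  chances of weight exp (- t), and equating the two gives t = D (ln n + ln ln n).

  A volume bound on neighbours counts with the ambient dimension in place of D, and three ranges
  make this affordable. Up to distance 1, the factor exp (- c t r) sums to a constant over a 1 / ln
  n-separated set, whatever its shape. Up to (ln n)^2, the number of neighbours is a power of ln n,
  while each pair gains a fixed negative power of n. Beyond, the bound C / s makes t times the
  common measure tend to 0, so these pairs are asymptotically independent.

  The gap bound 1 - c min s 1 is itself a consequence of the far bound C / s: a chain of equal steps
  that leads far away has to lose most of the lines on its way.\<close>

lemma range_in_lines:
  fixes p v :: "'a::euclidean_space"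
  assumes "v \<noteq> 0"
  shows "range (\<lambda>t. p + t *\<^sub>R v) \<in> lines"
proof -
  have "range (\<lambda>t. p + t *\<^sub>R v) = affine hull {p, p + v}"
    by (simp add: affine_hull_2_alt)
  then show ?thesis
    using assms by (simp add: lines_def)
qed

lemma lines_nonempty: "L \<in> lines \<Longrightarrow> L \<noteq> {}"
  by (auto simp: lines_def)

lemma lines_closed: "L \<in> lines \<Longrightarrow> closed L"
  by (simp add: lines_def affine_closed)

lemma lines_convex: "L \<in> lines \<Longrightarrow> convex L"
  by (simp add: lines_def affine_imp_convex)

lemma line_through:
  assumes "L \<in> lines" "p \<in> L"
  obtains v :: "'a::euclidean_space" where "norm v = 1" "L = range (\<lambda>t. p + t *\<^sub>R v)"
proof -
  have aff: "affine L" "aff_dim L = 1"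
    using assms by (auto simp: lines_def)
  have "L \<noteq> {p}"
    using aff by auto
  then obtain q where q: "q \<in> L" "q \<noteq> p"
    using assms by blast
  define v where "v = (q - p) /\<^sub>R norm (q - p)"
  have v: "norm v = 1"
    using q by (simp add: v_def)
  have "affine hull {p, q} \<subseteq> L"
    using assms q aff by (intro hull_minimal) auto
  then have "affine hull {p, q} = L"
    using aff q by (intro affine_dim_equal) auto
  moreover have "affine hull {p, q} = range (\<lambda>t. p + t *\<^sub>R v)"
  proof -
    have "range (\<lambda>t. p + t *\<^sub>R (q - p)) = range (\<lambda>t. p + t *\<^sub>R v)"
    proof (rule antisym)
      show "range (\<lambda>t. p + t *\<^sub>R (q - p)) \<subseteq> range (\<lambda>t. p + t *\<^sub>R v)"
      proof safe
        fix t
        have "p + t *\<^sub>R (q - p) = p + (t * norm (q - p)) *\<^sub>R v"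
          using q by (simp add: v_def)
        then show "p + t *\<^sub>R (q - p) \<in> range (\<lambda>t. p + t *\<^sub>R v)"
          by blast
      qed
      show "range (\<lambda>t. p + t *\<^sub>R v) \<subseteq> range (\<lambda>t. p + t *\<^sub>R (q - p))"
      proof safe
        fix t
        have "p + t *\<^sub>R v = p + (t / norm (q - p)) *\<^sub>R (q - p)"
          using q by (simp add: v_def divide_inverse)
        then show "p + t *\<^sub>R v \<in> range (\<lambda>t. p + t *\<^sub>R (q - p))"
          by blast
      qed
    qed
    then show ?thesis
      by (simp add: affine_hull_2_alt)
  qed
  ultimately show ?thesis
    using v that by blast
qed

lemma infdist_line_le_iff:
  assumes "L \<in> lines" 
  shows "infdist x L \<le> r \<longleftrightarrow> L \<inter> cball x r \<noteq> {}"
proof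
  assume le: "infdist x L \<le> r"
  obtain y where "y \<in> L" "infdist x L = dist x y"
    using infdist_attains_inf[OF lines_closed lines_nonempty] assms by metis
  then show "L \<inter> cball x r \<noteq> {}"
    using le by (metis disjoint_iff mem_cball)
next
  assume "L \<inter> cball x r \<noteq> {}"
  then obtain y where "y \<in> L" "dist x y \<le> r"
    by auto
  then show "infdist x L \<le> r"
    using infdist_le[of y L x] by linarith
qed

lemma image_line_in_lines:
  assumes "L \<in> lines" "linear f" "inj f"
  shows "f ` L \<in> lines"
proof -
  obtain p where "p \<in> L" using assms lines_nonempty by blast
  with assms obtain v where v: "norm v = 1" and L: "L = range (\<lambda>t. p + t *\<^sub>R v)"
    by (metis line_through)
  have "f v \<noteq> 0"
    using v assms by (metis injD linear_0 norm_zero zero_neq_one)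
  then have "range (\<lambda>t. f p + t *\<^sub>R f v) \<in> lines"
    by (rule range_in_lines)
  moreover have "f ` L = range (\<lambda>t. f p + t *\<^sub>R f v)"
    using assms by (auto simp: L linear_add linear_scale image_image)
  ultimately show ?thesis by simp
qed

lemma translate_line_in_lines:
  assumes "L \<in> lines" 
  shows "(+) a ` L \<in> lines"
  using assms affine_translation[of L a] by (simp add: lines_def aff_dim_translation_eq)

section \<open>Sets of lines hitting a ball, and measurability of the isometry action\<close>

definition hitting :: "'a::euclidean_space \<Rightarrow> real \<Rightarrow> 'a set set" where
  "hitting x r = {L \<in> lines. infdist x L \<le> r}"

lemma hitting_mono: "r \<le> s \<Longrightarrow> hitting x r \<subseteq> hitting x s"
  by (auto simp: hitting_def)

lemma hitting_alt: "hitting x r = {L \<in> lines. L \<inter> cball x r \<noteq> {}}"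
  unfolding hitting_def using infdist_line_le_iff by blast

lemma space_line_borel: "space line_borel = lines"
  unfolding line_borel_def by (rule space_measure_of) (auto simp: open_line_sets_def)

lemma open_line_sets_subset: "open_line_sets \<subseteq> Pow lines"
  by (auto simp: open_line_sets_def)

lemma open_line_sets_measurable: "U \<in> open_line_sets \<Longrightarrow> U \<in> sets line_borel"
  unfolding line_borel_def using open_line_sets_subset by auto

text \<open>In the parametrisation, meeting an open ball means that some parameter \<open>t\<close>
  gives a point of the ball, which is a union of open conditions on \<open>(p, v)\<close>.\<close>

lemma hitting_ball_open:
  "{L \<in> lines. L \<inter> ball x r \<noteq> {}} \<in> open_line_sets"
proof -
  have "{(p, v). v \<noteq> 0 \<and> range (\<lambda>t::real. p + t *\<^sub>R v) \<in> {L \<in> lines. L \<inter> ball x r \<noteq> {}}}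
     = {z. snd z \<noteq> 0} \<inter> (\<Union>t. {z. dist x (fst z + t *\<^sub>R snd z) < r})"
    by (auto simp: range_in_lines)
  moreover have "open ({z. snd z \<noteq> 0} \<inter> (\<Union>t. {z::'a\<times>'a. dist x (fst z + t *\<^sub>R snd z) < r}))"
    by (intro open_Int open_UN ballI open_Collect_less open_Collect_neq continuous_intros)
  ultimately show ?thesis
    by (auto simp: open_line_sets_def)
qed

lemma hitting_measurable [measurable]: "hitting x r \<in> sets line_borel"
proof -
  \<comment> \<open>Meeting the closed ball is not an open condition, but it is the countable
    intersection of the open conditions for slightly larger open balls.\<close>
  have "hitting x r = (\<Inter>k::nat. {L \<in> lines. L \<inter> ball x (r + 1 / Suc k) \<noteq> {}})"
  proof (intro equalityI subsetI INT_I)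
    fix L k assume "L \<in> hitting x r"
    then obtain y where y: "L \<in> lines" "y \<in> L" "dist x y \<le> r"
      unfolding hitting_alt using mem_cball by blast
    have "r < r + 1 / Suc k" by simp
    then have "y \<in> ball x (r + 1 / Suc k)"
      using y(3) unfolding mem_ball by linarith
    then show "L \<in> {L \<in> lines. L \<inter> ball x (r + 1 / Suc k) \<noteq> {}}"
      using y by blast
  next
    fix L assume L: "L \<in> (\<Inter>k::nat. {L \<in> lines. L \<inter> ball x (r + 1 / Suc k) \<noteq> {}})"
    have "infdist x L \<le> r + 1 / Suc k" for k :: nat
    proof -
      obtain y where "y \<in> L" "dist x y < r + 1 / Suc k"
        using L mem_ball by blast
      then show ?thesis
        using infdist_le[of y L x] by linarith
    qed
    moreover have "(\<lambda>k. r + 1 / real (Suc k)) \<longlonglongrightarrow> r + 0"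
      by (intro tendsto_intros LIMSEQ_Suc lim_const_over_n)
    ultimately have "infdist x L \<le> r"
      by (intro LIMSEQ_le_const[of "\<lambda>k. r + 1 / real (Suc k)"]) auto
    then show "L \<in> hitting x r"
      using L by (auto simp: hitting_def)
  qed
  also have "\<dots> \<in> sets line_borel"
    by (intro sets.countable_INT) (auto intro!: open_line_sets_measurable hitting_ball_open)
  finally show ?thesis .
qed

lemma infdist_measurable [measurable]: "(\<lambda>L. infdist x L) \<in> borel_measurable line_borel"
proof (rule borel_measurableI_le)
  fix r
  have "{L \<in> space line_borel. infdist x L \<le> r} = hitting x r"
    by (simp add: space_line_borel hitting_def)
  then show "{L \<in> space line_borel. infdist x L \<le> r} \<in> sets line_borel"
    by simp
qed

text \<open>Here \<open>g\<close> is the action of \<open>f\<close> on direction vectors: the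
  parameters \<open>(p, v)\<close> of a line become \<open>(f p, g v)\<close>, and continuity of
  this map carries openness back to preimages. Translations take the identity for \<open>g\<close>,
  orthogonal maps take \<open>f\<close> itself.\<close>

lemma measurable_line_borel_image:
  fixes f :: "'a::euclidean_space \<Rightarrow> 'a"
  assumes lines: "\<And>L. L \<in> lines \<Longrightarrow> f ` L \<in> lines"
    and line: "\<And>p v t. f (p + t *\<^sub>R v) = f p + t *\<^sub>R g v"
    and cont: "continuous_on UNIV f" "continuous_on UNIV g"
    and g0: "\<And>v. v \<noteq> 0 \<Longrightarrow> g v \<noteq> 0"
  shows "(`) f \<in> line_borel \<rightarrow>\<^sub>M line_borel"
proof -
  have "(`) f -` U \<inter> lines \<in> open_line_sets" if U: "U \<in> open_line_sets" for U
  proof -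
    let ?U = "{(p, v). v \<noteq> 0 \<and> range (\<lambda>t::real. p + t *\<^sub>R v) \<in> U}"
    have "{(p, v). v \<noteq> 0 \<and> range (\<lambda>t::real. p + t *\<^sub>R v) \<in> (`) f -` U \<inter> lines}
      = {z. snd z \<noteq> 0} \<inter> (\<lambda>z. (f (fst z), g (snd z))) -` ?U"
      by (auto simp: range_in_lines image_image line g0)
    moreover have "continuous_on UNIV (\<lambda>z. (f (fst z), g (snd z)))"
      by (intro continuous_intros continuous_on_compose2[OF cont(1)] continuous_on_compose2[OF cont(2)]) auto
    then have "open ((\<lambda>z. (f (fst z), g (snd z))) -` ?U)"
      using U by (intro open_vimage) (auto simp: open_line_sets_def)
    moreover have "open {z::'a \<times> 'a. snd z \<noteq> 0}"
      by (intro open_Collect_neq continuous_intros)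
    ultimately show ?thesis
      by (auto simp: open_line_sets_def)
  qed
  then show ?thesis
    using open_line_sets_subset lines unfolding line_borel_def
    by (intro measurable_measure_of)
      (auto simp: space_line_borel[unfolded line_borel_def]
         intro!: open_line_sets_measurable[unfolded line_borel_def])
qed

lemma translation_measurable: "(`) ((+) a) \<in> line_borel \<rightarrow>\<^sub>M line_borel"
proof (rule measurable_line_borel_image[where g="\<lambda>v. v"])
  show "(+) a ` L \<in> lines" if "L \<in> lines" for L
    using that by (rule translate_line_in_lines)
qed (auto intro!: continuous_intros simp: algebra_simps)

lemma orthogonal_measurable:
  fixes f :: "'a::euclidean_space \<Rightarrow> 'a"
  assumes "orthogonal_transformation f"
  shows "(`) f \<in> line_borel \<rightarrow>\<^sub>M line_borel"
proof (rule measurable_line_borel_image[where g=f])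
  have lin: "linear f" and inj: "inj f"
    using assms orthogonal_transformation_linear orthogonal_transformation_inj by auto
  show "f ` L \<in> lines" if "L \<in> lines" for L
    using image_line_in_lines that lin inj by blast
  show "f (p + t *\<^sub>R v) = f p + t *\<^sub>R f v" for p v t
    using lin by (simp add: linear_add linear_scale)
  show "continuous_on UNIV f"
    using lin by (simp add: linear_continuous_on linear_conv_bounded_linear)
  then show "continuous_on UNIV f" .
  show "f v \<noteq> 0" if "v \<noteq> 0" for v
    using that inj lin by (metis injD linear_0)
qed

lemma infdist_translate:
  fixes L :: "'a::real_normed_vector set"
  shows "infdist (a + x) ((+) a ` L) = infdist x L"
  by (simp add: infdist_def image_image)

lemma infdist_orthogonal_image:
  fixes f :: "'a::euclidean_space \<Rightarrow> 'a"
  assumes "orthogonal_transformation f"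
  shows "infdist (f x) (f ` L) = infdist x L"
  using assms
  by (simp add: infdist_def image_image dist_norm
      orthogonal_transformation_norm flip: linear_diff[OF orthogonal_transformation_linear])

text \<open>The distance to a convex set is a convex function, because the same convex combination
  of the two nearest points is a competitor.\<close>

lemma infdist_convex_le:
  fixes S :: "'a::euclidean_space set"
  assumes "convex S" "closed S" "S \<noteq> {}" "0 \<le> \<tau>" "\<tau> \<le> 1"
  shows "infdist ((1 - \<tau>) *\<^sub>R x + \<tau> *\<^sub>R y) S \<le> (1 - \<tau>) * infdist x S + \<tau> * infdist y S"
proof -
  obtain p q where p: "p \<in> S" "infdist x S = dist x p" and q: "q \<in> S" "infdist y S = dist y q"
    using infdist_attains_inf[OF assms(2,3)] by metis
  have "(1 - \<tau>) *\<^sub>R p + \<tau> *\<^sub>R q \<in> S"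
    using assms p q by (simp add: convex_alt)
  then have "infdist ((1 - \<tau>) *\<^sub>R x + \<tau> *\<^sub>R y) S
     \<le> dist ((1 - \<tau>) *\<^sub>R x + \<tau> *\<^sub>R y) ((1 - \<tau>) *\<^sub>R p + \<tau> *\<^sub>R q)"
    by (rule infdist_le)
  also have "\<dots> = norm ((1 - \<tau>) *\<^sub>R (x - p) + \<tau> *\<^sub>R (y - q))"
    by (simp add: dist_norm algebra_simps)
  also have "\<dots> \<le> (1 - \<tau>) * norm (x - p) + \<tau> * norm (y - q)"
    using assms by (intro norm_triangle_le) simp
  finally show ?thesis
    using p q by (simp add: dist_norm)
qed


text \<open>The reflection in the hyperplane orthogonal to \<open>a - b\<close> exchanges two
  vectors of equal norm.\<close>

lemma orthogonal_transformation_exists_euclidean: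
  fixes a b :: "'a::euclidean_space"
  assumes "norm a = norm b"
  obtains f where "orthogonal_transformation f" "f a = b"
proof (cases "a = b")
  case True
  then show ?thesis
    using that[of id] by (simp add: orthogonal_transformation_def linear_id)
next
  case False
  define w where "w = a - b"
  have w: "w \<bullet> w \<noteq> 0"
    using False by (simp add: w_def)
  define f where "f = (\<lambda>x. x - (2 * (x \<bullet> w) / (w \<bullet> w)) *\<^sub>R w)"
  have "linear f"
    by (rule linearI) (auto simp: f_def algebra_simps add_divide_distrib)
  moreover have "f x \<bullet> f y = x \<bullet> y" for x y
    using w by (simp add: f_def inner_diff_left inner_diff_right inner_commute field_simps)
  ultimately have "orthogonal_transformation f"
    by (simp add: orthogonal_transformation_def)
  moreover have "a \<bullet> a = b \<bullet> b"
    using assms by (simp add: norm_eq_sqrt_inner)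
  then have "2 * (a \<bullet> w) = w \<bullet> w"
    by (simp add: w_def inner_diff_left inner_diff_right inner_commute)
  then have "f a = b"
    using w by (simp add: f_def) (simp add: w_def)
  ultimately show ?thesis by (rule that)
qed

lemma bounded_finite_net:
  fixes A :: "'a::euclidean_space set"
  assumes "bounded A" "0 < e"
  obtains U where "finite U" "A \<subseteq> (\<Union>u\<in>U. ball u e)"
proof -
  obtain r where r: "A \<subseteq> cball 0 r"
    using bounded_subset_ballD[OF assms(1), of 0] ball_subset_cball by blast
  obtain U where "finite U" "cball 0 r \<subseteq> (\<Union>u\<in>U. ball (u::'a) e)"
    using compact_cball[of "0::'a" r] assms(2) unfolding compact_eq_totally_bounded by blast
  with r show ?thesis
    using that by blast
qed

section \<open>Estimates for the invariant measure\<close>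

locale invariant_lines =
  fixes \<mu> :: "'a::euclidean_space set measure"
  assumes invariant: "invariant_line_measure \<mu>"
    and dim_ge_2: "2 \<le> DIM('a)"
begin

lemma sets_eq [measurable_cong]: "sets \<mu> = sets line_borel"
  using invariant by (simp add: invariant_line_measure_def)

lemma space_eq: "space \<mu> = lines"
  using sets_eq_imp_space_eq[OF sets_eq] by (simp add: space_line_borel)

lemma hitting_sets [measurable, simp]: "hitting x r \<in> sets \<mu>"
  by (simp add: sets_eq)

text \<open>Invariance as a change of variables on predicates: combined with
  \<open>infdist_translate\<close> it moves the balls instead of the lines.\<close>

lemma emeasure_translate:
  assumes "{L \<in> lines. Q L} \<in> sets \<mu>"
  shows "emeasure \<mu> {L \<in> lines. Q ((+) a ` L)} = emeasure \<mu> {L \<in> lines. Q L}"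
proof -
  have "emeasure \<mu> {L \<in> lines. Q L} = emeasure (distr \<mu> \<mu> ((`) ((+) a))) {L \<in> lines. Q L}"
    using invariant by (simp add: invariant_line_measure_def)
  also have "\<dots> = emeasure \<mu> ((`) ((+) a) -` {L \<in> lines. Q L} \<inter> space \<mu>)"
    using assms translation_measurable by (intro emeasure_distr) (simp_all cong: measurable_cong_sets add: sets_eq)
  also have "(`) ((+) a) -` {L \<in> lines. Q L} \<inter> space \<mu> = {L \<in> lines. Q ((+) a ` L)}"
    using translate_line_in_lines by (auto simp: space_eq)
  finally show ?thesis by simp
qed

lemma emeasure_orthogonal:
  assumes "{L \<in> lines. Q L} \<in> sets \<mu>" and f: "orthogonal_transformation f"
  shows "emeasure \<mu> {L \<in> lines. Q (f ` L)} = emeasure \<mu> {L \<in> lines. Q L}"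
proof -
  have "emeasure \<mu> {L \<in> lines. Q L} = emeasure (distr \<mu> \<mu> ((`) f)) {L \<in> lines. Q L}"
    using invariant f by (simp add: invariant_line_measure_def)
  also have "\<dots> = emeasure \<mu> ((`) f -` {L \<in> lines. Q L} \<inter> space \<mu>)"
    using assms orthogonal_measurable[OF f]
    by (intro emeasure_distr) (simp_all cong: measurable_cong_sets add: sets_eq)
  also have "(`) f -` {L \<in> lines. Q L} \<inter> space \<mu> = {L \<in> lines. Q (f ` L)}"
    using image_line_in_lines orthogonal_transformation_linear[OF f] orthogonal_transformation_inj[OF f]
    by (auto simp: space_eq)
  finally show ?thesis by simp
qed

lemma emeasure_hitting_translate: "emeasure \<mu> (hitting (a + x) r) = emeasure \<mu> (hitting x r)"
  using emeasure_translate[of "\<lambda>L. infdist (a + x) L \<le> r" a]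
  by (simp add: infdist_translate flip: hitting_def)

lemma emeasure_hitting_1: "emeasure \<mu> (hitting x 1) = 1"
  using emeasure_hitting_translate[of x 0 1] invariant
  by (simp add: invariant_line_measure_def hitting_alt)

text \<open>The normalisation concerns unit balls only; any other ball is covered by finitely many
  of these, each hit by lines of measure 1.\<close>

lemma hitting_fmeasurable: "hitting x r \<in> fmeasurable \<mu>"
proof -
  obtain F where F: "finite F" "cball x r \<subseteq> (\<Union>y\<in>F. ball y 1)"
    using bounded_finite_net[OF bounded_cball zero_less_one] .
  have "hitting x r \<subseteq> (\<Union>y\<in>F. hitting y 1)"
  proof
    fix L assume "L \<in> hitting x r"
    then obtain z where z: "L \<in> lines" "z \<in> L" "z \<in> cball x r"
      unfolding hitting_alt by blast
    then obtain y where "y \<in> F" "dist y z < 1"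
      using F by auto
    then show "L \<in> (\<Union>y\<in>F. hitting y 1)"
      using z infdist_le[of z L y] by (force simp: hitting_def)
  qed
  then have "emeasure \<mu> (hitting x r) \<le> emeasure \<mu> (\<Union>y\<in>F. hitting y 1)"
    using F by (intro emeasure_mono) auto
  also have "\<dots> \<le> (\<Sum>y\<in>F. emeasure \<mu> (hitting y 1))"
    using F by (intro emeasure_subadditive_finite) auto
  also have "\<dots> = of_nat (card F)"
    by (simp add: emeasure_hitting_1)
  also have "\<dots> < \<infinity>"
    by (simp add: of_nat_less_top)
  finally show ?thesis
    by (intro fmeasurableI) auto
qed

lemma subset_hitting_fmeasurable:
  "B \<in> sets \<mu> \<Longrightarrow> B \<subseteq> hitting x r \<Longrightarrow> B \<in> fmeasurable \<mu>"
  by (rule fmeasurableI2[OF hitting_fmeasurable])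

lemma measure_hitting_1: "measure \<mu> (hitting x 1) = 1"
  by (simp add: measure_def emeasure_hitting_1)

section \<open>The measure of the lines hitting two unit balls\<close>

definition both :: "'a \<Rightarrow> 'a \<Rightarrow> real" where
  "both x y = measure \<mu> (hitting x 1 \<inter> hitting y 1)"

text \<open>A translation takes \<open>x\<close> and \<open>x'\<close> to the origin, and an
  orthogonal map takes \<open>y - x\<close> to \<open>y' - x'\<close>. Since only the distance
  matters, the arguments below may place the points wherever it is convenient.\<close>

lemma both_isometric:
  assumes "dist x y = dist x' y'"
  shows "both x y = both x' y'"
proof -
  have eq: "hitting x r \<inter> hitting y r = {L \<in> lines. infdist x L \<le> r \<and> infdist y L \<le> r}" for x y r
    by (auto simp: hitting_def)
  have [measurable]: "{L \<in> lines. infdist x L \<le> r \<and> infdist y L \<le> r} \<in> sets \<mu>" for x y r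
    by (simp flip: eq)
  have tr: "both (a + x) (a + y) = both x y" for a x y
    unfolding both_def eq measure_def
    using emeasure_translate[of "\<lambda>L. infdist (a + x) L \<le> 1 \<and> infdist (a + y) L \<le> 1" a]
    by (simp add: infdist_translate)
  obtain f where f: "orthogonal_transformation f" "f (y - x) = y' - x'"
    using orthogonal_transformation_exists_euclidean[of "y - x" "y' - x'"] assms
    by (metis dist_commute dist_norm)
  have f0: "f 0 = 0"
    using f orthogonal_transformation_linear linear_0 by blast
  have "both x' y' = both 0 (y' - x')"
    using tr[of x' 0 "y' - x'"] by simp
  also have "\<dots> = both 0 (y - x)"
    unfolding both_def eq measure_def
    using emeasure_orthogonal[of "\<lambda>L. infdist 0 L \<le> 1 \<and> infdist (y' - x') L \<le> 1" f] f
      infdist_orthogonal_image[OF f(1), of 0] infdist_orthogonal_image[OF f(1), of "y - x"]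
    by (simp add: f0)
  also have "\<dots> = both x y"
    using tr[of x 0 "y - x"] by simp
  finally show ?thesis ..
qed

lemma both_le_1: "both x y \<le> 1"
proof -
  have "both x y \<le> measure \<mu> (hitting x 1)"
    unfolding both_def by (intro measure_mono_fmeasurable hitting_fmeasurable) auto
  then show ?thesis by (simp add: measure_hitting_1)
qed

lemma both_nonneg: "0 \<le> both x y"
  by (simp add: both_def)

lemma measure_diff_hitting: "measure \<mu> (hitting x 1 - hitting y 1) = 1 - both x y"
proof -
  have "hitting x 1 - hitting y 1 = hitting x 1 - (hitting x 1 \<inter> hitting y 1)"
    by blast
  also have "measure \<mu> \<dots> = measure \<mu> (hitting x 1) - both x y"
    unfolding both_def
    by (intro measurable_measure_Diff hitting_fmeasurable) auto
  finally show ?thesis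
    by (simp add: measure_hitting_1)
qed

lemma measure_Un_hitting: "measure \<mu> (hitting x 1 \<union> hitting y 1) = 2 - both x y"
  using measure_Un3[OF hitting_fmeasurable[of x 1] hitting_fmeasurable[of y 1]]
  by (simp add: measure_hitting_1 both_def)

text \<open>The line leaves the unit ball at the origin in the direction of \<open>y\<close> or \<open>- y\<close>, and likewise of
  \<open>z\<close> or \<open>- z\<close>; the signs agree because the angle between \<open>y\<close> and \<open>z\<close> is not obtuse.\<close>

lemma hitting_two_close:
  assumes L: "L \<in> hitting 0 1" "L \<in> hitting y 1" "L \<in> hitting z 1"
    and n: "norm y = s" "norm z = s" and yz: "0 \<le> y \<bullet> z" and s: "9 \<le> s"
  shows "dist y z \<le> 8"
proof -
  obtain p where p: "p \<in> L" "norm p \<le> 1" and lin: "L \<in> lines"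
    using L(1) unfolding hitting_alt by auto
  obtain v where v: "norm v = 1" and Lv: "L = range (\<lambda>t. p + t *\<^sub>R v)"
    using line_through[OF lin p(1)] by blast
  \<comment> \<open>The line comes within 1 of the origin at \<open>p\<close> and within 1 of
    \<open>w\<close> at parameter \<open>t\<close>; the two errors add up to 2.\<close>
  have near: "\<exists>t. norm (w - t *\<^sub>R v) \<le> 2 \<and> \<bar>\<bar>t\<bar> - s\<bar> \<le> 2" if w: "L \<in> hitting w 1" "norm w = s" for w
  proof -
    obtain q where "q \<in> L" "dist w q \<le> 1"
      using w(1) mem_cball unfolding hitting_alt by blast
    then obtain t where t: "norm (w - (p + t *\<^sub>R v)) \<le> 1"
      by (auto simp: Lv dist_norm)
    have "norm (w - t *\<^sub>R v) = norm ((w - (p + t *\<^sub>R v)) + p)"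
      by (simp add: algebra_simps)
    also have "\<dots> \<le> 2"
      using norm_triangle_ineq[of "w - (p + t *\<^sub>R v)" p] t p(2) by linarith
    finally have "norm (w - t *\<^sub>R v) \<le> 2" .
    moreover have "\<bar>norm w - norm (t *\<^sub>R v)\<bar> \<le> norm (w - t *\<^sub>R v)"
      by (rule norm_triangle_ineq3)
    ultimately show ?thesis
      using v w(2) by (intro exI[of _ t]) auto
  qed
  obtain a where a: "norm (y - a *\<^sub>R v) \<le> 2" "\<bar>\<bar>a\<bar> - s\<bar> \<le> 2" using near L n by blast
  obtain b where b: "norm (z - b *\<^sub>R v) \<le> 2" "\<bar>\<bar>b\<bar> - s\<bar> \<le> 2" using near L n by blast
  consider "\<bar>a - b\<bar> \<le> 4" | "\<bar>a + b\<bar> \<le> 4"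
    using a b by linarith
  then show ?thesis
  proof cases
    case 1
    have "y - z = (y - a *\<^sub>R v) + ((a - b) *\<^sub>R v - (z - b *\<^sub>R v))"
      by (simp add: scaleR_diff_left)
    moreover have "norm ((y - a *\<^sub>R v) + ((a - b) *\<^sub>R v - (z - b *\<^sub>R v))) \<le>
        norm (y - a *\<^sub>R v) + (norm ((a - b) *\<^sub>R v) + norm (z - b *\<^sub>R v))"
      by (meson add_left_mono norm_triangle_ineq norm_triangle_ineq4 order_trans)
    ultimately have "dist y z \<le> norm (y - a *\<^sub>R v) + (norm ((a - b) *\<^sub>R v) + norm (z - b *\<^sub>R v))"
      by (metis dist_norm)
    then show ?thesis
      using a b 1 v by simp
  next
    \<comment> \<open>This case is contradictory: it gives a norm of \<open>y + z\<close> of at most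
      2 + 4 + 2 = 8, whereas the non-obtuse angle makes its square at least 2 * 81.\<close>
    case 2
    have "y + z = (y - a *\<^sub>R v) + ((a + b) *\<^sub>R v + (z - b *\<^sub>R v))"
      by (simp add: scaleR_add_left)
    moreover have "norm ((y - a *\<^sub>R v) + ((a + b) *\<^sub>R v + (z - b *\<^sub>R v))) \<le>
        norm (y - a *\<^sub>R v) + (norm ((a + b) *\<^sub>R v) + norm (z - b *\<^sub>R v))"
      by (meson add_left_mono norm_triangle_ineq order_trans)
    ultimately have "norm (y + z) \<le> norm (y - a *\<^sub>R v) + (norm ((a + b) *\<^sub>R v) + norm (z - b *\<^sub>R v))"
      by metis
    then have "norm (y + z) \<le> 8"
      using a b 2 v by simp
    then have "(norm (y + z))\<^sup>2 \<le> 8\<^sup>2"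
      by (intro power_mono) auto
    moreover have "(norm (y + z))\<^sup>2 = (norm y)\<^sup>2 + (norm z)\<^sup>2 + 2 * (y \<bullet> z)"
      by (simp add: power2_norm_eq_inner inner_add_left inner_add_right inner_commute)
    moreover have "9\<^sup>2 \<le> s\<^sup>2"
      using s by (intro power_mono) auto
    ultimately show ?thesis
      using yz n by simp
  qed
qed

text \<open>One quadrant of a plane circle of radius \<open>s\<close> has room for about
  \<open>s / 9\<close> points that are more than 8 apart. The lines from the unit ball at the origin
  to the unit balls at these points form disjoint sets of equal measure, and together they have
  measure at most 1. For \<open>s\<close> below 9 the claim is weaker than
  \<open>both_le_1\<close>.\<close>

lemma both_le_inverse:
  assumes "0 < dist x y"
  shows "both x y \<le> 9 / dist x y"
proof (cases "dist x y < 9")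
  case True
  then have "1 \<le> 9 / dist x y"
    using assms by simp
  then show ?thesis
    using both_le_1[of x y] by linarith
next
  case False
  define s where "s = dist x y"
  have s: "9 \<le> s" using False by (simp add: s_def)
  obtain e :: 'a where e: "e \<in> Basis" by (meson nonempty_Basis ex_in_conv)
  obtain e' :: 'a where e': "e' \<in> Basis" "e' \<noteq> e"
  proof -
    have "\<not> Basis \<subseteq> {e}"
      using dim_ge_2 card_mono[of "{e}" Basis] by auto
    then show ?thesis using that by blast
  qed
  define M where "M = nat \<lfloor>s / 9\<rfloor>"
  \<comment> \<open>The first coordinates are spaced by 9, more than the 8 of
    \<open>hitting_two_close\<close>, and the second coordinate puts the point on the sphere of
    radius \<open>s\<close>. Up to index \<open>M\<close> both coordinates are nonnegative, so no
    angle is obtuse.\<close>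
  define z where "z k = (9 * real k) *\<^sub>R e + sqrt (s\<^sup>2 - (9 * real k)\<^sup>2) *\<^sub>R e'" for k :: nat
  have M: "9 * real k \<le> s" if "k \<le> M" for k
  proof -
    have "real k \<le> s / 9"
      using that s unfolding M_def by linarith
    then show ?thesis by simp
  qed
  then have sq: "(9 * real k)\<^sup>2 \<le> s\<^sup>2" if "k \<le> M" for k
    using that by (intro power_mono) auto
  have inn: "e \<bullet> e = 1" "e' \<bullet> e' = 1" "e \<bullet> e' = 0" "e' \<bullet> e = 0"
    using e e' by (auto simp: inner_Basis)
  have nz: "norm (z k) = s" if "k \<le> M" for k
  proof -
    have "z k \<bullet> z k = s\<^sup>2"
      using sq[OF that]
      by (simp add: z_def inner_add_left inner_add_right inn power2_eq_square
         flip: real_sqrt_mult)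
    then show ?thesis
      using s by (simp add: norm_eq_sqrt_inner)
  qed
  have nn: "0 \<le> z k \<bullet> z j" if "k \<le> M" "j \<le> M" for j k
    using sq that by (simp add: z_def inner_add_left inner_add_right inn)
  have far: "8 < dist (z k) (z j)" if "k \<noteq> j" for j k
  proof -
    have "\<bar>(z k - z j) \<bullet> e\<bar> \<le> norm (z k - z j)"
      using Basis_le_norm[OF e] .
    moreover have "(z k - z j) \<bullet> e = 9 * (real k - real j)"
      by (simp add: z_def inner_diff_left inner_add_left inn)
    moreover have "1 \<le> \<bar>real k - real j\<bar>"
      using that by linarith
    ultimately show ?thesis
      by (simp add: dist_norm abs_mult)
  qed
  have disj: "disjoint_family_on (\<lambda>k. hitting 0 1 \<inter> hitting (z k) 1) {..M}"
    unfolding disjoint_family_on_def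
    using hitting_two_close[OF _ _ _ nz nz nn s] far by (fastforce simp: not_le)
  have fm: "hitting 0 1 \<inter> hitting (z k) 1 \<in> fmeasurable \<mu>" for k
    by (intro fmeasurable_Int_fmeasurable hitting_fmeasurable) auto
  have "real (Suc M) * both x y = (\<Sum>k\<le>M. both 0 (z k))"
  proof -
    have "both 0 (z k) = both x y" if "k \<le> M" for k
      using nz[OF that] by (intro both_isometric) (simp add: s_def)
    then show ?thesis by simp
  qed
  also have "\<dots> = measure \<mu> (\<Union>k\<in>{..M}. hitting 0 1 \<inter> hitting (z k) 1)"
    unfolding both_def
    using fm disj fmeasurableD2[OF fm] by (intro measure_finite_Union[symmetric]) auto
  also have "\<dots> \<le> measure \<mu> (hitting 0 1)"
    by (intro measure_mono_fmeasurable hitting_fmeasurable) auto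
  also have "\<dots> = 1"
    by (rule measure_hitting_1)
  finally have "real (Suc M) * both x y \<le> 1" .
  \<comment> \<open>The index 0 adds one point, which compensates for the rounding down in
    \<open>M\<close>.\<close>
  moreover have "s / 9 \<le> real (Suc M)"
    unfolding M_def using s by linarith
  ultimately have "s / 9 * both x y \<le> 1"
    by (meson both_nonneg mult_right_mono order_trans)
  then show ?thesis
    using s by (simp add: field_simps flip: s_def)
qed

end

section \<open>Linear estimates: the gap for nearby balls and the loss from shrinking a ball\<close>

context invariant_lines
begin

text \<open>A chain of steps of length \<open>s\<close> runs from \<open>z 0\<close> to a point at
  distance at least 36, where \<open>both\<close> is at most 9 / 36 = 1 / 4. So lines of measure at
  least 3 / 4 hit the first ball but not the last, and each of them is lost at some step. Every step
  loses the same amount \<open>1 - both x y\<close> and there are at most \<open>72 / s\<close>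
  steps, hence the loss per step is at least (3 / 4) (s / 72) = s / 96.\<close>

lemma both_le_gap: "both x y \<le> 1 - min (dist x y) 1 / 96"
proof -
  define s where "s = dist x y"
  consider "s = 0" | "36 \<le> s" | "0 < s" "s < 36"
    using zero_le_dist[of x y] unfolding s_def by linarith
  then show ?thesis
  proof cases
    case 1
    then show ?thesis using both_le_1 by (simp add: s_def)
  next
    case 2
    then have "both x y \<le> 9 / s"
      using both_le_inverse[of x y] unfolding s_def by linarith
    also have "\<dots> \<le> 9 / 36"
      using 2 by (intro divide_left_mono) auto
    finally show ?thesis
      using 2 by (simp add: s_def)
  next
    case 3
    obtain e :: 'a where e: "e \<in> Basis" by (meson nonempty_Basis ex_in_conv)
    define M where "M = nat \<lceil>36 / s\<rceil>"
    define z where "z k = (real k * s) *\<^sub>R e" for k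
    have "36 / s \<le> real M"
      unfolding M_def by linarith
    then have Ms: "36 \<le> real M * s"
      using 3 by (simp add: field_simps)
    have M2: "real M \<le> 72 / s"
    proof -
      have "real M \<le> 36 / s + 1"
        unfolding M_def using \<open>0 < s\<close> by simp
      also have "1 \<le> 36 / s"
        using 3 by simp
      finally show ?thesis by simp
    qed
    have "dist (z 0) (z M) = real M * s"
      using 3 e by (simp add: z_def dist_norm abs_mult)
    then have "both (z 0) (z M) \<le> 9 / (real M * s)"
      using both_le_inverse[of "z 0" "z M"] Ms by simp
    also have "\<dots> \<le> 9 / 36"
      using Ms by (intro divide_left_mono) auto
    finally have "3 / 4 \<le> measure \<mu> (hitting (z 0) 1 - hitting (z M) 1)"
      unfolding measure_diff_hitting by simp
    also have "\<dots> \<le> measure \<mu> (\<Union>k<M. hitting (z k) 1 - hitting (z (Suc k)) 1)"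
    proof (rule measure_mono_fmeasurable)
      show "hitting (z 0) 1 - hitting (z M) 1 \<subseteq> (\<Union>k<M. hitting (z k) 1 - hitting (z (Suc k)) 1)"
      proof
        fix L assume L: "L \<in> hitting (z 0) 1 - hitting (z M) 1"
        show "L \<in> (\<Union>k<M. hitting (z k) 1 - hitting (z (Suc k)) 1)"
        proof (rule ccontr)
          assume neg: "L \<notin> (\<Union>k<M. hitting (z k) 1 - hitting (z (Suc k)) 1)"
          have "k \<le> M \<Longrightarrow> L \<in> hitting (z k) 1" for k
            by (induction k) (use L neg in auto)
          with L show False by blast
        qed
      qed
      show "(\<Union>k<M. hitting (z k) 1 - hitting (z (Suc k)) 1) \<in> fmeasurable \<mu>"
        by (intro fmeasurable.finite_UN) (auto intro: subset_hitting_fmeasurable)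
    qed auto
    also have "\<dots> \<le> (\<Sum>k<M. measure \<mu> (hitting (z k) 1 - hitting (z (Suc k)) 1))"
      by (intro measure_UNION_le) auto
    also have "\<dots> = (\<Sum>k<M. 1 - both x y)"
    proof (intro sum.cong refl)
      fix k
      have "z (Suc k) - z k = s *\<^sub>R e"
        by (simp add: z_def algebra_simps)
      then have "dist (z (Suc k)) (z k) = s"
        using 3 e by (simp add: dist_norm)
      then have "both (z k) (z (Suc k)) = both x y"
        by (intro both_isometric) (simp add: s_def dist_commute)
      then show "measure \<mu> (hitting (z k) 1 - hitting (z (Suc k)) 1) = 1 - both x y"
        by (simp add: measure_diff_hitting)
    qed
    also have "\<dots> = real M * (1 - both x y)"
      by simp
    also have "\<dots> \<le> 72 / s * (1 - both x y)"
      using M2 both_le_1[of x y] by (intro mult_right_mono) auto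
    finally have "s / 96 \<le> 1 - both x y"
      using 3 by (simp add: field_simps)
    then show ?thesis
      by (simp add: s_def[symmetric] min_def) 
  qed
qed

text \<open>Lines that hit the unit ball at \<open>a\<close> but miss the ball shrunk by
  \<open>\<epsilon>\<close>, restricted to those that lie roughly in direction \<open>u\<close>:
  going to \<open>a + u\<close> brings them nearer by a definite amount. This makes the set
  transversal to translations along \<open>u\<close>.\<close>

definition shell :: "real \<Rightarrow> 'a \<Rightarrow> 'a \<Rightarrow> 'a set set" where
  "shell \<epsilon> u a = {L \<in> lines. 1 - \<epsilon> < infdist a L \<and> infdist a L \<le> 1 \<and>
     infdist (a + u) L \<le> infdist a L - 1 / 4}"

lemma shell_sets: "shell \<epsilon> u a \<in> sets \<mu>"
proof -
  have "shell \<epsilon> u a = {L \<in> space line_borel. 1 - \<epsilon> < infdist a L \<and> infdist a L \<le> 1 \<and>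
     infdist (a + u) L \<le> infdist a L - 1 / 4}"
    by (simp add: shell_def space_line_borel)
  also have "\<dots> \<in> sets line_borel"
    by measurable
  finally show ?thesis by (simp add: sets_eq)
qed

lemma measure_shell_translate: "measure \<mu> (shell \<epsilon> u a) = measure \<mu> (shell \<epsilon> u 0)"
proof -
  let ?Q = "\<lambda>L. 1 - \<epsilon> < infdist a L \<and> infdist a L \<le> 1 \<and> infdist (a + u) L \<le> infdist a L - 1 / 4"
  have "infdist a ((+) a ` L) = infdist 0 L" for L
    using infdist_translate[of a 0 L] by simp
  then have "{L \<in> lines. ?Q ((+) a ` L)} = shell \<epsilon> u 0"
    by (simp add: shell_def infdist_translate)
  moreover have "{L \<in> lines. ?Q L} = shell \<epsilon> u a"
    by (simp add: shell_def)
  ultimately show ?thesis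
    using emeasure_translate[of ?Q a] shell_sets[of \<epsilon> u a] by (simp add: measure_def)
qed

text \<open>By convexity, the distance to a line in \<open>shell \<epsilon> u a\<close> decreases at rate at least \<open>1 / 4\<close>
  when moving from \<open>a\<close> to \<open>a + u\<close>, so that steps of length \<open>4 * \<epsilon>\<close> (in units of \<open>u\<close>) make the
  translates of the shell disjoint.\<close>

lemma measure_shell_le:
  assumes "0 < \<epsilon>"
  shows "measure \<mu> (shell \<epsilon> u 0) \<le> 4 * \<epsilon> * measure \<mu> (hitting 0 (1 + norm u))"
proof -
  \<comment> \<open>Up to index \<open>M\<close> the point \<open>a k\<close> stays on the segment
    from 0 to \<open>u\<close>. This keeps all translates among the lines that hit one fixed ball,
    and it keeps the convexity parameter \<open>\<tau>\<close> at most 1.\<close>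
  define M where "M = nat \<lfloor>1 / (4 * \<epsilon>)\<rfloor>"
  define a where "a k = (4 * \<epsilon> * real k) *\<^sub>R u" for k
  have M: "4 * \<epsilon> * real k \<le> 1" if "k \<le> M" for k
  proof -
    have "0 \<le> 1 / (4 * \<epsilon>)"
      using assms by simp
    then have "real k \<le> 1 / (4 * \<epsilon>)"
      using that unfolding M_def by linarith
    then show ?thesis using assms by (simp add: field_simps)
  qed
  have sub: "shell \<epsilon> u (a k) \<subseteq> hitting 0 (1 + norm u)" if "k \<le> M" for k
  proof
    fix L assume L: "L \<in> shell \<epsilon> u (a k)"
    have "infdist 0 L \<le> infdist (a k) L + dist 0 (a k)"
      by (rule infdist_triangle)
    also have "dist 0 (a k) \<le> 1 * norm u"
    proof -
      have "dist 0 (a k) = 4 * \<epsilon> * real k * norm u"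
        using assms by (simp add: a_def abs_mult)
      also have "\<dots> \<le> 1 * norm u"
        using M[OF that] by (intro mult_right_mono) auto
      finally show ?thesis .
    qed
    finally show "L \<in> hitting 0 (1 + norm u)"
      using L by (simp add: shell_def hitting_def)
  qed
  have "shell \<epsilon> u (a k) \<inter> shell \<epsilon> u (a l) = {}" if "k < l" "l \<le> M" for k l
  proof (rule ccontr)
    assume "shell \<epsilon> u (a k) \<inter> shell \<epsilon> u (a l) \<noteq> {}"
    then obtain L where L: "L \<in> shell \<epsilon> u (a k)" "L \<in> shell \<epsilon> u (a l)" by blast
    then have lin: "L \<in> lines" by (simp add: shell_def)
    define \<tau> where "\<tau> = 4 * \<epsilon> * (real l - real k)"
    have "1 \<le> real l - real k" using that by linarith
    then have "4 * \<epsilon> * 1 \<le> \<tau>"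
      unfolding \<tau>_def using assms by (intro mult_left_mono) auto
    then have \<tau>0: "4 * \<epsilon> \<le> \<tau>" by simp
    have "\<tau> \<le> 4 * \<epsilon> * real l"
      unfolding \<tau>_def using assms by (intro mult_left_mono) auto
    then have \<tau>1: "\<tau> \<le> 1"
      using M[OF that(2)] by linarith
    have "(1 - \<tau>) *\<^sub>R a k + \<tau> *\<^sub>R (a k + u) = a k + \<tau> *\<^sub>R u"
      by (simp add: algebra_simps)
    also have "\<dots> = a l"
      by (simp add: a_def \<tau>_def algebra_simps)
    finally have "infdist (a l) L \<le> (1 - \<tau>) * infdist (a k) L + \<tau> * infdist (a k + u) L"
      using infdist_convex_le[OF lines_convex[OF lin] lines_closed[OF lin] lines_nonempty[OF lin], of \<tau> "a k" "a k + u"]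
        \<tau>0 \<tau>1 assms by simp
    also have "\<dots> \<le> (1 - \<tau>) * infdist (a k) L + \<tau> * (infdist (a k) L - 1 / 4)"
      using L(1) \<tau>0 assms by (intro add_left_mono mult_left_mono) (auto simp: shell_def)
    also have "\<dots> = infdist (a k) L - \<tau> / 4"
      by (simp add: algebra_simps)
    also have "\<dots> \<le> 1 - \<epsilon>"
      using L(1) \<tau>0 by (simp add: shell_def)
    finally show False
      using L(2) by (simp add: shell_def)
  qed
  then have disj: "disjoint_family_on (\<lambda>k. shell \<epsilon> u (a k)) {..M}"
    unfolding disjoint_family_on_def by (metis Int_commute atMost_iff linorder_neqE_nat)
  have fm: "shell \<epsilon> u (a k) \<in> fmeasurable \<mu>" if "k \<le> M" for k
    using sub[OF that] shell_sets by (rule subset_hitting_fmeasurable[rotated])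
  have "real (Suc M) * measure \<mu> (shell \<epsilon> u 0) = (\<Sum>k\<le>M. measure \<mu> (shell \<epsilon> u (a k)))"
    by (simp add: measure_shell_translate[of \<epsilon> u "a _"])
  also have "\<dots> = measure \<mu> (\<Union>k\<in>{..M}. shell \<epsilon> u (a k))"
    using fm disj fmeasurableD2[OF fm] by (intro measure_finite_Union[symmetric]) auto
  also have "\<dots> \<le> measure \<mu> (hitting 0 (1 + norm u))"
    using sub by (intro measure_mono_fmeasurable hitting_fmeasurable) (auto intro: shell_sets)
  finally have "real (Suc M) * measure \<mu> (shell \<epsilon> u 0) \<le> measure \<mu> (hitting 0 (1 + norm u))" .
  moreover have "1 / (4 * \<epsilon>) \<le> real (Suc M)"
    unfolding M_def using assms by linarith
  ultimately have "1 / (4 * \<epsilon>) * measure \<mu> (shell \<epsilon> u 0) \<le> measure \<mu> (hitting 0 (1 + norm u))"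
    by (meson measure_nonneg mult_right_mono order_trans)
  then show ?thesis
    using assms by (simp add: field_simps)
qed

text \<open>The lines lost by shrinking the ball are sorted by their point \<open>q\<close> nearest
  to the centre. As \<open>norm q\<close> exceeds 1 / 2, a member \<open>u\<close> of a finite net
  with mesh 1 / 4 is closer to the line by at least 1 / 4 than the centre is, so the line lies in
  the shell of \<open>u\<close>. The net, and with it \<open>C\<close>, does not depend on
  \<open>\<epsilon>\<close>.\<close>

lemma measure_hitting_ge:
  obtains C where "0 < C" "\<And>\<epsilon> x. 0 < \<epsilon> \<Longrightarrow> \<epsilon> \<le> 1 / 2 \<Longrightarrow> 1 - C * \<epsilon> \<le> measure \<mu> (hitting x (1 - \<epsilon>))"
proof -
  obtain U where U: "finite U" "cball 0 1 \<subseteq> (\<Union>u\<in>U. ball (u::'a) (1 / 4))"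
    by (rule bounded_finite_net[OF bounded_cball, of "1 / 4" "0::'a" 1]) simp_all
  define C where "C = 1 + (\<Sum>u\<in>U. 4 * measure \<mu> (hitting 0 (1 + norm u)))"
  have "0 < C"
    unfolding C_def by (intro add_pos_nonneg sum_nonneg) auto
  moreover have "1 - C * \<epsilon> \<le> measure \<mu> (hitting x (1 - \<epsilon>))" if \<epsilon>: "0 < \<epsilon>" "\<epsilon> \<le> 1 / 2" for \<epsilon> x
  proof -
    have sub: "hitting 0 1 - hitting 0 (1 - \<epsilon>) \<subseteq> (\<Union>u\<in>U. shell \<epsilon> u 0)"
    proof
      fix L assume L: "L \<in> hitting 0 1 - hitting (0::'a) (1 - \<epsilon>)"
      then have lin: "L \<in> lines" by (simp add: hitting_def)
      obtain q where q: "q \<in> L" "infdist 0 L = dist 0 q"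
        using infdist_attains_inf[OF lines_closed[OF lin] lines_nonempty[OF lin]] by metis
      then have nq: "1 - \<epsilon> < norm q" "norm q \<le> 1"
        using L by (auto simp: hitting_def not_le)
      then obtain u where u: "u \<in> U" "dist u q < 1 / 4"
        using U by auto
      have "infdist u L \<le> norm q - 1 / 4"
        using infdist_le[OF q(1), of u] u nq \<epsilon> by linarith
      then show "L \<in> (\<Union>u\<in>U. shell \<epsilon> u 0)"
        using u nq q lin by (auto simp: shell_def)
    qed
    have fm: "shell \<epsilon> u 0 \<in> fmeasurable \<mu>" for u
      by (rule subset_hitting_fmeasurable[OF shell_sets, of _ _ _ 0 1]) (auto simp: shell_def hitting_def)
    have "measure \<mu> (hitting 0 1) - measure \<mu> (hitting 0 (1 - \<epsilon>)) = measure \<mu> (hitting 0 1 - hitting 0 (1 - \<epsilon>))"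
      using hitting_mono[of "1 - \<epsilon>" 1 0] \<epsilon>
      by (intro measurable_measure_Diff[symmetric] hitting_fmeasurable) auto
    also have "\<dots> \<le> measure \<mu> (\<Union>u\<in>U. shell \<epsilon> u 0)"
      using sub U fm by (intro measure_mono_fmeasurable fmeasurable.finite_UN) auto
    also have "\<dots> \<le> (\<Sum>u\<in>U. measure \<mu> (shell \<epsilon> u 0))"
      using U shell_sets by (intro measure_UNION_le) auto
    also have "\<dots> \<le> (\<Sum>u\<in>U. 4 * \<epsilon> * measure \<mu> (hitting 0 (1 + norm u)))"
      using \<epsilon> by (intro sum_mono measure_shell_le)
    also have "\<dots> \<le> C * \<epsilon>"
      using \<epsilon> by (simp add: C_def sum_distrib_left sum_distrib_right algebra_simps)
    finally have "1 - C * \<epsilon> \<le> measure \<mu> (hitting 0 (1 - \<epsilon>))"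
      by (simp add: measure_hitting_1)
    then show ?thesis
      using emeasure_hitting_translate[of x 0 "1 - \<epsilon>"] by (simp add: measure_def)
  qed
  ultimately show ?thesis using that by blast
qed

end

section \<open>Covering by Poisson cylinders\<close>

definition covers :: "('a::euclidean_space set \<times> real) set \<Rightarrow> 'a set \<Rightarrow> real \<Rightarrow> bool" where
  "covers \<psi> A t \<longleftrightarrow> A \<subseteq> (\<Union>(L, s)\<in>{(L, s). (L, s) \<in> \<psi> \<and> s \<le> t}. cylinder L)"

lemma cover_time_alt: "cover_time \<psi> A = Inf {ereal t | t. 0 < t \<and> covers \<psi> A t}"
  by (simp add: cover_time_def covers_def)

lemma covers_iff: "covers \<psi> A t \<longleftrightarrow> (\<forall>x\<in>A. \<exists>L s. (L, s) \<in> \<psi> \<and> s \<le> t \<and> infdist x L \<le> 1)"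
  by (auto simp: covers_def cylinder_def subset_eq)

lemma covers_mono: "covers \<psi> A s \<Longrightarrow> s \<le> t \<Longrightarrow> covers \<psi> A t"
  unfolding covers_iff by (meson order_trans)

lemma cover_time_le: "0 < t \<Longrightarrow> covers \<psi> A t \<Longrightarrow> cover_time \<psi> A \<le> ereal t"
  unfolding cover_time_alt by (rule Inf_lower) auto

lemma cover_time_lessD:
  assumes "cover_time \<psi> A < y"
  obtains t where "0 < t" "ereal t < y" "covers \<psi> A t"
  using assms unfolding cover_time_alt Inf_less_iff by auto

lemma cover_time_nonneg: "0 \<le> cover_time \<psi> A"
  unfolding cover_time_alt by (rule Inf_greatest) auto

text \<open>By local finiteness, the covered region is closed within a bounded set.\<close>

lemma covers_dense:
  assumes "locally_finite_lines \<psi>" "\<psi> \<subseteq> lines \<times> {0..}" "bounded A" "D \<subseteq> A" "A \<subseteq> closure D"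
  shows "covers \<psi> A t \<longleftrightarrow> covers \<psi> D t"
proof
  assume "covers \<psi> A t"
  then show "covers \<psi> D t"
    using assms by (auto simp: covers_def)
next
  assume cov: "covers \<psi> D t"
  obtain R where R: "\<And>x. x \<in> A \<Longrightarrow> norm x \<le> R"
    using assms(3) bounded_iff by blast
  \<comment> \<open>The axis of a cylinder that contains a point of \<open>A\<close> comes within
    \<open>R + 1\<close> of the origin, so \<open>F\<close> retains every relevant cylinder.\<close>
  define F where "F = {(L, s). (L, s) \<in> \<psi> \<and> L \<inter> cball 0 (R + 2) \<noteq> {} \<and> s \<le> t}"
  have "finite F"
    using assms(1) unfolding locally_finite_lines_def F_def by blast
  then have "closed (\<Union>(L, s)\<in>F. {x. infdist x L \<le> 1})"
    by (intro closed_UN) (auto intro!: closed_Collect_le continuous_intros)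
  moreover have "D \<subseteq> (\<Union>(L, s)\<in>F. {x. infdist x L \<le> 1})"
  proof
    fix x assume x: "x \<in> D"
    then obtain L s where L: "(L, s) \<in> \<psi>" "s \<le> t" "infdist x L \<le> 1"
      using cov by (auto simp: covers_iff)
    then show "x \<in> (\<Union>(L, s)\<in>F. {x. infdist x L \<le> 1})"
    proof -
      have "L \<in> lines" using L(1) assms(2) by auto
      then obtain q where q: "q \<in> L" "dist x q \<le> 1"
        using infdist_line_le_iff[of L x 1] L(3) mem_cball by blast
      have "norm q \<le> norm x + dist x q"
        by (metis dist_norm norm_triangle_sub norm_minus_commute)
      also have "\<dots> \<le> R + 2"
        using R[of x] x assms(4) q by auto
      finally have "q \<in> L \<inter> cball 0 (R + 2)"
        using q by simp
      then have "(L, s) \<in> F"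
        using L unfolding F_def by blast
      then show ?thesis
        using L(3) by blast
    qed
  qed
  ultimately have "closure D \<subseteq> (\<Union>(L, s)\<in>F. {x. infdist x L \<le> 1})"
    by (rule closure_minimal[rotated])
  then show "covers \<psi> A t"
    using assms(5) unfolding covers_iff F_def by fastforce
qed

section \<open>The Poisson line process: void probabilities and measurability of the cover
  time\<close>

locale line_process = invariant_lines \<mu>
  for \<mu> :: "'a::euclidean_space set measure" +
  fixes P :: "'w measure" and \<Psi> :: "'w \<Rightarrow> ('a set \<times> real) set"
  assumes process: "poisson_line_process P \<mu> \<Psi>"
begin

sublocale prob_space P
  using process by (simp add: poisson_line_process_def poisson_point_process_def)

text \<open>The void event of \<open>H\<close> up to time \<open>t\<close>. Both tails are expressed
  through such events, for the lines hitting one ball or one of two balls.\<close>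

definition missed :: "'a set set \<Rightarrow> real \<Rightarrow> 'w set" where
  "missed H t = {\<omega> \<in> space P. \<Psi> \<omega> \<inter> (H \<times> {0..t}) = {}}"

lemma points_subset: "\<omega> \<in> space P \<Longrightarrow> \<Psi> \<omega> \<subseteq> lines \<times> {0..}"
  using process
  by (simp add: poisson_line_process_def poisson_point_process_def space_pair_measure
      space_restrict_space space_eq)

text \<open>This is the case of zero points in the Poisson law, for a set of intensity
  \<open>t * measure \<mu> H\<close>.\<close>

lemma
  assumes H: "H \<in> fmeasurable \<mu>" and t: "0 \<le> t"
  shows missed_sets: "missed H t \<in> events"
    and prob_missed: "prob (missed H t) = exp (- t * measure \<mu> H)"
proof -
  let ?T = "restrict_space lborel {0::real..}"
  interpret T: sigma_finite_measure ?T
    by (intro sigma_finite_measure_restrict_space sigma_finite_lborel) auto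
  define B where "B = H \<times> {0..t}"
  have T: "{0..t} \<in> sets ?T"
    by (subst sets_restrict_space_iff) auto
  have H': "H \<in> sets \<mu>" using H by auto
  have B: "B \<in> sets (\<mu> \<Otimes>\<^sub>M ?T)"
    unfolding B_def using H' T by (rule pair_measureI)
  have "emeasure (\<mu> \<Otimes>\<^sub>M ?T) B = emeasure \<mu> H * emeasure ?T {0..t}"
    unfolding B_def using H' T by (rule T.emeasure_pair_measure_Times)
  also have "emeasure ?T {0..t} = ennreal t"
    using t by (subst emeasure_restrict_space) auto
  also have "emeasure \<mu> H = ennreal (measure \<mu> H)"
    using H by (simp add: emeasure_eq_measure2)
  finally have em: "emeasure (\<mu> \<Otimes>\<^sub>M ?T) B = ennreal (measure \<mu> H * t)"
    using t by (simp add: ennreal_mult)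
  have eq: "missed H t = {\<omega> \<in> space P. num_points \<Psi> B \<omega> = of_nat 0}"
    by (simp add: missed_def B_def num_points_def emeasure_count_space_eq_0)
  have "num_points \<Psi> B \<in> borel_measurable P"
    using B process by (simp add: poisson_line_process_def poisson_point_process_def)
  then show "missed H t \<in> events"
    unfolding eq by measurable
  have "measure (\<mu> \<Otimes>\<^sub>M ?T) B = measure \<mu> H * t"
    using em t by (simp add: measure_def)
  moreover have "prob {\<omega> \<in> space P. num_points \<Psi> B \<omega> = of_nat 0}
       = measure (\<mu> \<Otimes>\<^sub>M ?T) B ^ 0 / fact 0 * exp (- measure (\<mu> \<Otimes>\<^sub>M ?T) B)"
  proof -
    have "emeasure (\<mu> \<Otimes>\<^sub>M ?T) B < \<infinity>"
      by (simp add: em)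
    moreover have "\<forall>B\<in>sets (\<mu> \<Otimes>\<^sub>M ?T). emeasure (\<mu> \<Otimes>\<^sub>M ?T) B < \<infinity> \<longrightarrow>
        (\<forall>k::nat. prob {\<omega> \<in> space P. num_points \<Psi> B \<omega> = of_nat k}
           = measure (\<mu> \<Otimes>\<^sub>M ?T) B ^ k / fact k * exp (- measure (\<mu> \<Otimes>\<^sub>M ?T) B))"
      using process unfolding poisson_line_process_def poisson_point_process_def by (elim conjE)
    ultimately show ?thesis
      using B by blast
  qed
  ultimately show "prob (missed H t) = exp (- t * measure \<mu> H)"
    unfolding eq by (simp add: mult.commute)
qed

lemma covers_point_iff:
  assumes "\<omega> \<in> space P"
  shows "covers (\<Psi> \<omega>) D t \<longleftrightarrow> (\<forall>x\<in>D. \<omega> \<notin> missed (hitting x 1) t)"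
proof -
  have "(\<exists>L s. (L, s) \<in> \<Psi> \<omega> \<and> s \<le> t \<and> infdist x L \<le> 1) \<longleftrightarrow> \<Psi> \<omega> \<inter> (hitting x 1 \<times> {0..t}) \<noteq> {}" for x
  proof
    assume "\<exists>L s. (L, s) \<in> \<Psi> \<omega> \<and> s \<le> t \<and> infdist x L \<le> 1"
    then obtain L s where L: "(L, s) \<in> \<Psi> \<omega>" "s \<le> t" "infdist x L \<le> 1"
      by blast
    then have "(L, s) \<in> hitting x 1 \<times> {0..t}"
      using points_subset[OF assms] by (auto simp: hitting_def)
    then show "\<Psi> \<omega> \<inter> (hitting x 1 \<times> {0..t}) \<noteq> {}"
      using L by blast
  qed (auto simp: hitting_def)
  then show ?thesis
    using assms by (simp add: covers_iff missed_def)
qed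

text \<open>Coverage of \<open>A\<close> is an intersection over possibly uncountably many points;
  by \<open>covers_dense\<close> a countable dense subset decides it.\<close>

lemma covers_sets:
  assumes "bounded A" "0 \<le> t"
  shows "{\<omega> \<in> space P. covers (\<Psi> \<omega>) A t} \<in> events"
proof -
  obtain D where D: "countable D" "D \<subseteq> A" "A \<subseteq> closure D"
    using separable by metis
  have "{\<omega> \<in> space P. covers (\<Psi> \<omega>) A t} = {\<omega> \<in> space P. \<forall>x\<in>D. \<omega> \<notin> missed (hitting x 1) t}"
    using covers_dense[OF _ points_subset assms(1) D(2,3)] process covers_point_iff
    by (auto simp: poisson_line_process_def)
  also have "\<dots> = space P - (\<Union>x\<in>D. missed (hitting x 1) t)"
    by blast
  also have "\<dots> \<in> events"
    using missed_sets[OF hitting_fmeasurable assms(2)] D(1)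
    by (intro sets.Diff sets.countable_UN') auto
  finally show ?thesis .
qed

lemma cover_time_measurable:
  assumes "bounded A"
  shows "(\<lambda>\<omega>. cover_time (\<Psi> \<omega>) A) \<in> borel_measurable P"
proof (rule borel_measurableI_less)
  fix y
  \<comment> \<open>Coverage is monotone in time, so a covering time below \<open>y\<close> can be
    replaced by a rational one and the union becomes countable. The real \<open>z\<close> in between
    deals with infinite \<open>y\<close>.\<close>
  have less_iff: "cover_time (\<Psi> \<omega>) A < y \<longleftrightarrow> (\<exists>q\<in>{q\<in>\<rat>. 0 < q \<and> ereal q < y}. covers (\<Psi> \<omega>) A q)" for \<omega>
  proof
    assume "cover_time (\<Psi> \<omega>) A < y"
    then obtain t where t: "0 < t" "ereal t < y" "covers (\<Psi> \<omega>) A t"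
      by (rule cover_time_lessD)
    obtain z where z: "t < z" "ereal z < y"
      using ereal_dense2[OF t(2)] by auto
    obtain q where q: "q \<in> \<rat>" "t < q" "q < z"
      using Rats_dense_in_real[OF z(1)] by auto
    have "ereal q < ereal z"
      using q(3) by simp
    also have "\<dots> < y" by (rule z(2))
    finally have "ereal q < y" .
    moreover have "0 < q" "covers (\<Psi> \<omega>) A q"
      using t(1) q(2) covers_mono[OF t(3), of q] by auto
    ultimately show "\<exists>q\<in>{q\<in>\<rat>. 0 < q \<and> ereal q < y}. covers (\<Psi> \<omega>) A q"
      using q(1) by auto
  next
    assume "\<exists>q\<in>{q\<in>\<rat>. 0 < q \<and> ereal q < y}. covers (\<Psi> \<omega>) A q"
    then obtain q where q: "0 < q" "ereal q < y" "covers (\<Psi> \<omega>) A q"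
      by auto
    show "cover_time (\<Psi> \<omega>) A < y"
      using cover_time_le[OF q(1,3)] q(2) by (rule le_less_trans)
  qed
  have "{\<omega> \<in> space P. cover_time (\<Psi> \<omega>) A < y} =
      (\<Union>q\<in>{q\<in>\<rat>. 0 < q \<and> ereal q < y}. {\<omega> \<in> space P. covers (\<Psi> \<omega>) A q})"
    unfolding less_iff by blast
  also have "\<dots> \<in> events"
    using covers_sets[OF assms]
    by (intro sets.countable_UN' countable_subset[OF _ countable_rat]) auto
  finally show "{\<omega> \<in> space P. cover_time (\<Psi> \<omega>) A < y} \<in> events" .
qed

end

section \<open>First and second moment bounds at a fixed time\<close>

context line_process
begin

text \<open>If \<open>x\<close> is uncovered at time \<open>t\<close> and \<open>a\<close> is within
  \<open>\<epsilon>\<close> of \<open>x\<close>, then every line present by time \<open>t\<close>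
  stays further than \<open>1 - \<epsilon>\<close> from \<open>a\<close>. So uncovered points near
  \<open>a\<close> all force the same void event, and a union bound over \<open>S\<close>
  remains.\<close>

lemma prob_cover_time_gt:
  assumes S: "finite S" "A \<subseteq> (\<Union>a\<in>S. cball a \<epsilon>)" and t: "0 < t"
    and c: "\<And>a. c \<le> measure \<mu> (hitting a (1 - \<epsilon>))"
  shows "prob {\<omega> \<in> space P. ereal t < cover_time (\<Psi> \<omega>) A} \<le> card S * exp (- t * c)"
proof -
  have "{\<omega> \<in> space P. ereal t < cover_time (\<Psi> \<omega>) A} \<subseteq> (\<Union>a\<in>S. missed (hitting a (1 - \<epsilon>)) t)"
  proof
    fix \<omega> assume \<omega>: "\<omega> \<in> {\<omega> \<in> space P. ereal t < cover_time (\<Psi> \<omega>) A}"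
    then have "\<not> covers (\<Psi> \<omega>) A t"
      using cover_time_le[OF t, of "\<Psi> \<omega>" A] by auto
    then obtain x where x: "x \<in> A" "\<And>L s. (L, s) \<in> \<Psi> \<omega> \<Longrightarrow> s \<le> t \<Longrightarrow> 1 < infdist x L"
      unfolding covers_iff by (meson not_le)
    obtain a where a: "a \<in> S" "dist a x \<le> \<epsilon>"
      using S(2) x(1) by auto
    have "(L, s) \<notin> \<Psi> \<omega>" if "(L, s) \<in> hitting a (1 - \<epsilon>) \<times> {0..t}" for L s
    proof
      assume "(L, s) \<in> \<Psi> \<omega>"
      then have "1 < infdist x L"
        using x(2) that by auto
      also have "\<dots> \<le> infdist a L + dist x a"
        by (rule infdist_triangle)
      also have "\<dots> \<le> 1"
        using that a(2) by (simp add: hitting_def dist_commute)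
      finally show False by simp
    qed
    then show "\<omega> \<in> (\<Union>a\<in>S. missed (hitting a (1 - \<epsilon>)) t)"
      using a(1) \<omega> unfolding missed_def by blast
  qed
  then have "prob {\<omega> \<in> space P. ereal t < cover_time (\<Psi> \<omega>) A} \<le> prob (\<Union>a\<in>S. missed (hitting a (1 - \<epsilon>)) t)"
    using S(1) t by (intro finite_measure_mono sets.finite_UN missed_sets hitting_fmeasurable) auto
  also have "\<dots> \<le> (\<Sum>a\<in>S. prob (missed (hitting a (1 - \<epsilon>)) t))"
    using S(1) t by (intro measure_UNION_le missed_sets hitting_fmeasurable) auto
  also have "\<dots> \<le> (\<Sum>a\<in>S. exp (- t * c))"
    using t c by (intro sum_mono) (simp add: prob_missed hitting_fmeasurable)
  finally show ?thesis by simp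
qed

text \<open>Second moment method for the number \<open>Z\<close> of points of \<open>Y\<close>
  uncovered at time \<open>t\<close>. Earlier coverage forces \<open>Z = 0\<close>, a deviation from
  the mean as large as the mean. Two points are uncovered together with probability exp (- t (2 -
  both x y)), so division by the squared mean leaves the factors
  \<open>exp (t * both x y)\<close>.\<close>

lemma prob_cover_time_less:
  assumes Y: "finite Y" "Y \<noteq> {}" "Y \<subseteq> A" and t: "0 < t"
  shows "prob {\<omega> \<in> space P. cover_time (\<Psi> \<omega>) A < ereal t}
    \<le> (\<Sum>x\<in>Y. \<Sum>y\<in>Y. exp (t * both x y)) / (real (card Y))\<^sup>2 - 1"
proof -
  define m where "m = real (card Y)"
  have m: "0 < m" using Y by (simp add: m_def card_gt_0_iff)
  define E where "E x = missed (hitting x 1) t" for x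
  have E [measurable]: "E x \<in> events" for x
    unfolding E_def using t by (intro missed_sets hitting_fmeasurable) auto
  define Z where "Z \<omega> = (\<Sum>x\<in>Y. indicator (E x) \<omega> :: real)" for \<omega>
  have Zm [measurable]: "Z \<in> borel_measurable P"
    unfolding Z_def by measurable
  have pE: "prob (E x) = exp (- t)" for x
    using t by (simp add: E_def prob_missed hitting_fmeasurable measure_hitting_1)
  have pE2: "prob (E x \<inter> E y) = exp (- 2 * t) * exp (t * both x y)" for x y
  proof -
    have "E x \<inter> E y = missed (hitting x 1 \<union> hitting y 1) t"
      by (auto simp: E_def missed_def)
    also have "prob \<dots> = exp (- t * (2 - both x y))"
      using t by (simp add: prob_missed measure_Un_hitting fmeasurable.Un hitting_fmeasurable)
    also have "\<dots> = exp (- 2 * t) * exp (t * both x y)"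
      by (simp add: algebra_simps flip: exp_add)
    finally show ?thesis .
  qed
  have Z2: "(Z \<omega>)\<^sup>2 = (\<Sum>x\<in>Y. \<Sum>y\<in>Y. indicator (E x \<inter> E y) \<omega>)" for \<omega>
    by (simp add: Z_def power2_eq_square sum_product indicator_inter_arith)
  have intE: "integrable P (indicator (E x) :: 'w \<Rightarrow> real)" "integrable P (indicator (E x \<inter> E y) :: 'w \<Rightarrow> real)" for x y
    by (auto intro!: integrable_real_indicator simp: less_top[symmetric])
  have intZ: "integrable P Z" "integrable P (\<lambda>\<omega>. (Z \<omega>)\<^sup>2)"
    unfolding Z2 unfolding Z_def by (auto intro!: Bochner_Integration.integrable_sum intE)
  have EZ: "expectation Z = m * exp (- t)"
    unfolding Z_def using intE by (simp add: pE m_def)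
  have EZ2: "expectation (\<lambda>\<omega>. (Z \<omega>)\<^sup>2) = exp (- 2 * t) * (\<Sum>x\<in>Y. \<Sum>y\<in>Y. exp (t * both x y))"
    unfolding Z2 using intE by (simp add: pE2 sum_distrib_left)
  have pos: "0 < expectation Z"
    using m by (simp add: EZ)
  have "prob {\<omega> \<in> space P. cover_time (\<Psi> \<omega>) A < ereal t} \<le> prob {\<omega> \<in> space P. expectation Z \<le> \<bar>Z \<omega> - expectation Z\<bar>}"
  proof (intro finite_measure_mono)
    show "{\<omega> \<in> space P. cover_time (\<Psi> \<omega>) A < ereal t} \<subseteq> {\<omega> \<in> space P. expectation Z \<le> \<bar>Z \<omega> - expectation Z\<bar>}"
    proof safe
      fix \<omega> assume \<omega>: "\<omega> \<in> space P" "cover_time (\<Psi> \<omega>) A < ereal t"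
      obtain s where s: "0 < s" "ereal s < ereal t" "covers (\<Psi> \<omega>) A s"
        using \<omega>(2) by (rule cover_time_lessD)
      then have "covers (\<Psi> \<omega>) A t"
        by (intro covers_mono[OF s(3)]) simp
      then have "covers (\<Psi> \<omega>) Y t"
        using Y(3) unfolding covers_def by blast
      then have "Z \<omega> = 0"
        using covers_point_iff[OF \<omega>(1)] by (simp add: Z_def E_def)
      then show "expectation Z \<le> \<bar>Z \<omega> - expectation Z\<bar>"
        by simp
    qed
  qed measurable
  also have "\<dots> \<le> variance Z / (expectation Z)\<^sup>2"
    using pos by (intro Chebyshev_inequality intZ) auto
  also have "\<dots> = expectation (\<lambda>\<omega>. (Z \<omega>)\<^sup>2) / (expectation Z)\<^sup>2 - 1"
    using pos by (subst variance_eq[OF intZ]) (simp add: diff_divide_distrib)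
  also have "expectation (\<lambda>\<omega>. (Z \<omega>)\<^sup>2) / (expectation Z)\<^sup>2 = (\<Sum>x\<in>Y. \<Sum>y\<in>Y. exp (t * both x y)) / m\<^sup>2"
    unfolding EZ EZ2 by (simp add: power_mult_distrib flip: exp_double)
  finally show ?thesis
    by (simp add: m_def)
qed

end

section \<open>Separated sets and box counts\<close>

definition separated :: "real \<Rightarrow> 'a::metric_space set \<Rightarrow> bool" where
  "separated \<delta> X \<longleftrightarrow> (\<forall>x\<in>X. \<forall>y\<in>X. x \<noteq> y \<longrightarrow> \<delta> \<le> dist x y)"

text \<open>Volume comparison: the balls of radius \<open>\<delta> / 2\<close> around the points are
  disjoint and lie in the ball of radius \<open>\<rho> + \<delta> / 2\<close>.\<close>

lemma card_separated_le:
  fixes X :: "'a::euclidean_space set"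
  assumes X: "finite X" "separated \<delta> X" "X \<subseteq> cball a \<rho>" and \<delta>: "0 < \<delta>" and \<rho>: "0 \<le> \<rho>"
  shows "real (card X) \<le> (2 * \<rho> / \<delta> + 1) ^ DIM('a)"
proof -
  define v where "v = measure lborel (ball (0::'a) 1)"
  have v: "0 < v" by (simp add: v_def)
  have meas_ball: "measure lborel (ball x r) = v * r ^ DIM('a)" if "0 \<le> r" for x :: 'a and r
    using that by (simp add: v_def content_ball)
  have disj: "disjoint_family_on (\<lambda>x. ball x (\<delta> / 2)) X"
    unfolding disjoint_family_on_def
  proof (intro ballI impI)
    fix x y assume xy: "x \<in> X" "y \<in> X" "x \<noteq> y"
    then have "\<delta> / 2 + \<delta> / 2 \<le> dist x y"
      using X(2) by (auto simp: separated_def)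
    then show "ball x (\<delta> / 2) \<inter> ball y (\<delta> / 2) = {}"
      by (rule disjoint_ballI)
  qed
  have "real (card X) * (v * (\<delta> / 2) ^ DIM('a)) = (\<Sum>x\<in>X. measure lborel (ball x (\<delta> / 2)))"
    using \<delta> by (simp add: meas_ball)
  also have "\<dots> = measure lborel (\<Union>x\<in>X. ball x (\<delta> / 2))"
    using X(1) disj by (intro measure_finite_Union[symmetric]) (use emeasure_lborel_ball_finite in \<open>auto simp: less_top\<close>)
  also have "\<dots> \<le> measure lborel (ball a (\<rho> + \<delta> / 2))"
  proof (rule measure_mono_fmeasurable)
    show "(\<Union>x\<in>X. ball x (\<delta> / 2)) \<subseteq> ball a (\<rho> + \<delta> / 2)"
    proof
      fix z assume "z \<in> (\<Union>x\<in>X. ball x (\<delta> / 2))"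
      then obtain x where "x \<in> X" "dist x z < \<delta> / 2" by auto
      moreover from this have "dist a x \<le> \<rho>" using X(3) by auto
      ultimately show "z \<in> ball a (\<rho> + \<delta> / 2)"
        using dist_triangle[of a z x] by simp
    qed
    show "ball a (\<rho> + \<delta> / 2) \<in> fmeasurable lborel"
      using emeasure_lborel_ball_finite by (intro fmeasurableI) auto
  qed (auto intro: borel_open)
  also have "\<dots> = v * (\<rho> + \<delta> / 2) ^ DIM('a)"
    using \<delta> \<rho> by (simp add: meas_ball)
  finally have "real (card X) * (\<delta> / 2) ^ DIM('a) \<le> (\<rho> + \<delta> / 2) ^ DIM('a)"
    using v by (simp add: algebra_simps)
  then have "real (card X) \<le> (\<rho> + \<delta> / 2) ^ DIM('a) / (\<delta> / 2) ^ DIM('a)"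
    using \<delta> by (simp add: pos_le_divide_eq)
  also have "\<dots> = (2 * \<rho> / \<delta> + 1) ^ DIM('a)"
    using \<delta> by (simp add: add_divide_distrib mult.commute flip: power_divide)
  finally show ?thesis .
qed

lemma power_le_fact_exp:
  fixes x :: real
  assumes "0 \<le> x"
  shows "x ^ n \<le> fact n * exp x"
proof -
  have "x ^ n /\<^sub>R fact n \<le> (\<Sum>k. x ^ k /\<^sub>R fact k)"
    using sum_le_suminf[OF summable_exp_generic[of x], of "{n}"] assms by simp
  then show ?thesis
    by (simp add: exp_def field_simps)
qed

text \<open>The points are grouped by the integer part k of their distance in units of
  \<open>\<delta>\<close>. Packing allows at most (2 k + 3) ^ DIM('a) points in a group; half of the
  exponential decay pays for this, and a geometric series of ratio \<open>exp (- a / 2)\<close>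
  remains. The bound depends neither on \<open>\<delta>\<close> nor on the number of points.\<close>

lemma separated_exp_sum:
  fixes X :: "'a::euclidean_space set"
  assumes X: "finite X" "separated \<delta> X" and \<delta>: "0 < \<delta>" and a: "0 < a"
  shows "(\<Sum>y\<in>X. exp (- a * (dist x y / \<delta>)))
    \<le> (4 / a) ^ DIM('a) * fact DIM('a) * exp (3 * a / 4) / (1 - exp (- a / 2))"
proof -
  define c where "c = (4 / a) ^ DIM('a) * fact DIM('a) * exp (3 * a / 4)"
  define q where "q = exp (- a / 2)"
  have c: "0 \<le> c" and q: "0 < q" "q < 1" using a by (auto simp: c_def q_def)
  define j where "j y = nat \<lfloor>dist x y / \<delta>\<rfloor>" for y
  have j: "real (j y) \<le> dist x y / \<delta>" "dist x y / \<delta> \<le> real (j y) + 1" for y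
  proof -
    have "0 \<le> dist x y / \<delta>" using \<delta> by simp
    then show "real (j y) \<le> dist x y / \<delta>" "dist x y / \<delta> \<le> real (j y) + 1"
      unfolding j_def by linarith+
  qed
  have shell: "real (card {y \<in> X. j y = k}) * exp (- a * real k) \<le> c * q ^ k" for k
  proof -
    have "{y \<in> X. j y = k} \<subseteq> cball x ((real k + 1) * \<delta>)"
      using j(2) \<delta> by (auto simp: field_simps)
    then have "real (card {y \<in> X. j y = k}) \<le> (2 * ((real k + 1) * \<delta>) / \<delta> + 1) ^ DIM('a)"
      using X \<delta> by (intro card_separated_le[of _ _ x]) (auto simp: separated_def)
    \<comment> \<open>Written so that \<open>power_le_fact_exp\<close> applies to
      \<open>(2 * real k + 3) * a / 4\<close>, whose exponential grows only like exp (a k /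
      2).\<close>
    also have "2 * ((real k + 1) * \<delta>) / \<delta> + 1 = (4 / a) * ((2 * real k + 3) * a / 4)"
      using \<delta> a by (simp add: field_simps)
    also have "\<dots> ^ DIM('a) = (4 / a) ^ DIM('a) * ((2 * real k + 3) * a / 4) ^ DIM('a)"
      by (rule power_mult_distrib)
    also have "\<dots> \<le> (4 / a) ^ DIM('a) * (fact DIM('a) * exp ((2 * real k + 3) * a / 4))"
      using a by (intro mult_left_mono power_le_fact_exp) auto
    finally have "real (card {y \<in> X. j y = k}) * exp (- a * real k)
      \<le> (4 / a) ^ DIM('a) * (fact DIM('a) * exp ((2 * real k + 3) * a / 4)) * exp (- a * real k)"
      by (rule mult_right_mono) auto
    also have "\<dots> = (4 / a) ^ DIM('a) * fact DIM('a) * exp ((2 * real k + 3) * a / 4 + - a * real k)"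
      by (simp only: exp_add mult.assoc)
    also have "(2 * real k + 3) * a / 4 + - a * real k = 3 * a / 4 + real k * (- a / 2)"
      by (simp add: field_simps)
    also have "exp (3 * a / 4 + real k * (- a / 2)) = exp (3 * a / 4) * q ^ k"
      unfolding q_def by (simp only: exp_add exp_of_nat_mult)
    finally show ?thesis by (simp add: c_def mult_ac)
  qed
  have "(\<Sum>y\<in>X. exp (- a * (dist x y / \<delta>))) \<le> (\<Sum>y\<in>X. exp (- a * real (j y)))"
    using mult_left_mono[OF j(1), of a] a by (intro sum_mono) simp
  also have "\<dots> = (\<Sum>k\<in>j ` X. \<Sum>y\<in>{y \<in> X. j y = k}. exp (- a * real (j y)))"
    using X(1) by (intro sum.group[symmetric]) auto
  also have "\<dots> = (\<Sum>k\<in>j ` X. real (card {y \<in> X. j y = k}) * exp (- a * real k))"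
    by (intro sum.cong) auto
  also have "\<dots> \<le> (\<Sum>k\<in>j ` X. c * q ^ k)"
    by (intro sum_mono shell)
  also have "\<dots> = c * (\<Sum>k\<in>j ` X. q ^ k)"
    by (simp add: sum_distrib_left)
  also have "(\<Sum>k\<in>j ` X. q ^ k) \<le> (\<Sum>k. q ^ k)"
    using X(1) q by (intro sum_le_suminf summable_geometric) auto
  also have "(\<Sum>k. q ^ k) = 1 / (1 - q)"
    using q by (intro suminf_geometric) auto
  finally show ?thesis
    using c by (simp add: c_def q_def mult_left_mono)
qed

section \<open>Box counts compared with packings\<close>

lemma box_cover_exists:
  fixes A :: "'a::euclidean_space set"
  assumes "bounded A" "0 < \<delta>"
  obtains S where "finite S" "card S = box_count \<delta> A" "A \<subseteq> (\<Union>a\<in>S. cbox a (a + \<delta> *\<^sub>R One))"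
proof -
  obtain U where U: "finite U" "A \<subseteq> (\<Union>u\<in>U. ball u (\<delta> / 2))"
    using bounded_finite_net[OF assms(1), of "\<delta> / 2"] assms(2) by auto
  define S where "S = (\<lambda>u. u - (\<delta> / 2) *\<^sub>R One) ` U"
  have "A \<subseteq> (\<Union>a\<in>S. cbox a (a + \<delta> *\<^sub>R One))"
  proof
    fix x assume "x \<in> A"
    then obtain u where u: "u \<in> U" "dist u x < \<delta> / 2"
      using U by auto
    have "x \<in> cbox (u - (\<delta> / 2) *\<^sub>R One) (u - (\<delta> / 2) *\<^sub>R One + \<delta> *\<^sub>R One)"
    proof (unfold mem_box, rule ballI)
      fix i :: 'a assume i: "i \<in> Basis"
      have "\<bar>u \<bullet> i - x \<bullet> i\<bar> < \<delta> / 2"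
        using Basis_le_norm[OF i, of "u - x"] u(2) by (simp add: dist_norm inner_diff_left)
      moreover have "(u - (\<delta> / 2) *\<^sub>R One) \<bullet> i = u \<bullet> i - \<delta> / 2"
        "(u - (\<delta> / 2) *\<^sub>R One + \<delta> *\<^sub>R One) \<bullet> i = u \<bullet> i + \<delta> / 2"
        using i by (simp_all add: inner_diff_left inner_add_left)
      ultimately show "(u - (\<delta> / 2) *\<^sub>R One) \<bullet> i \<le> x \<bullet> i \<and> x \<bullet> i \<le> (u - (\<delta> / 2) *\<^sub>R One + \<delta> *\<^sub>R One) \<bullet> i"
        unfolding abs_less_iff by auto
    qed
    then show "x \<in> (\<Union>a\<in>S. cbox a (a + \<delta> *\<^sub>R One))"
      using u(1) by (auto simp: S_def)
  qed
  moreover have "finite S" using U by (simp add: S_def)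
  \<comment> \<open>Boundedness supplies one finite cover, so the \<open>LEAST\<close> in
    \<open>box_count\<close> is attained instead of being an unspecified value.\<close>
  ultimately have "\<exists>k. \<exists>S. finite S \<and> card S = k \<and> A \<subseteq> (\<Union>a\<in>S. cbox a (a + \<delta> *\<^sub>R One))"
    by blast
  then have "\<exists>S. finite S \<and> card S = box_count \<delta> A \<and> A \<subseteq> (\<Union>a\<in>S. cbox a (a + \<delta> *\<^sub>R One))"
    unfolding box_count_def by (rule LeastI_ex)
  then show ?thesis using that by blast
qed

lemma box_count_le:
  assumes "finite S" "A \<subseteq> (\<Union>a\<in>S. cbox a (a + \<delta> *\<^sub>R One))"
  shows "box_count \<delta> A \<le> card S"
  unfolding box_count_def by (rule Least_le) (use assms in blast)

lemma cbox_subset_cball: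
  fixes a :: "'a::euclidean_space"
  assumes "0 \<le> \<delta>"
  shows "cbox a (a + \<delta> *\<^sub>R One) \<subseteq> cball a (\<delta> * DIM('a))"
proof
  fix x assume x: "x \<in> cbox a (a + \<delta> *\<^sub>R One)"
  have "norm (x - a) \<le> (\<Sum>i\<in>Basis. \<bar>(x - a) \<bullet> i\<bar>)"
    by (rule norm_le_l1)
  also have "\<dots> \<le> (\<Sum>i\<in>(Basis::'a set). \<delta>)"
    using x by (intro sum_mono) (auto simp: mem_box inner_diff_left inner_add_left abs_le_iff algebra_simps)
  finally show "x \<in> cball a (\<delta> * DIM('a))"
    by (simp add: dist_norm norm_minus_commute mult.commute)
qed

text \<open>The packing bound limits the size of separated subsets of \<open>A\<close>, so a largest
  one exists; a point of \<open>A\<close> at distance at least \<open>\<delta>\<close> from all of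
  its members could be added to it.\<close>

lemma maximal_separated_exists:
  fixes A :: "'a::euclidean_space set"
  assumes "bounded A" "0 < \<delta>"
  obtains X where "finite X" "X \<subseteq> A" "separated \<delta> X" "A \<subseteq> (\<Union>x\<in>X. ball x \<delta>)"
proof -
  obtain R where R: "0 < R" "A \<subseteq> cball 0 R"
    using bounded_subset_ballD[OF assms(1), of 0] ball_subset_cball by blast
  let ?P = "\<lambda>X. finite X \<and> X \<subseteq> A \<and> separated \<delta> X"
  have "card X \<le> nat \<lfloor>(2 * R / \<delta> + 1) ^ DIM('a)\<rfloor>" if "?P X" for X
  proof -
    have "real (card X) \<le> (2 * R / \<delta> + 1) ^ DIM('a)"
      using that R assms(2) by (intro card_separated_le[of X \<delta> 0 R]) auto
    then show ?thesis
      by (simp add: le_nat_floor)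
  qed
  moreover have "?P {}" by (simp add: separated_def)
  ultimately have "\<exists>X. ?P X \<and> (\<forall>Y. ?P Y \<longrightarrow> card Y \<le> card X)"
    by (intro ex_has_greatest_nat[of ?P "{}" card "Suc (nat \<lfloor>(2 * R / \<delta> + 1) ^ DIM('a)\<rfloor>)"])
      (auto simp: less_Suc_eq_le)
  then obtain X where X: "?P X" "\<And>Y. ?P Y \<Longrightarrow> card Y \<le> card X"
    by auto
  have "A \<subseteq> (\<Union>x\<in>X. ball x \<delta>)"
  proof
    fix y assume y: "y \<in> A"
    show "y \<in> (\<Union>x\<in>X. ball x \<delta>)"
    proof (rule ccontr)
      assume "y \<notin> (\<Union>x\<in>X. ball x \<delta>)"
      then have far: "\<delta> \<le> dist x y" if "x \<in> X" for x
        using that by (auto simp: not_less)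
      then have "separated \<delta> (insert y X)"
        using X(1) unfolding separated_def by (metis dist_commute insert_iff)
      then have "card (insert y X) \<le> card X"
        using X(1) y by (intro X(2)) auto
      moreover have "y \<notin> X"
        using far[of y] assms(2) by auto
      ultimately show False
        using X(1) by simp
    qed
  qed
  then show ?thesis using that X(1) by blast
qed

text \<open>A maximal separated set is also a net, and the ball of radius \<open>\<delta>\<close>
  around a point fits into a box of side \<open>2 * \<delta>\<close>.\<close>

lemma separated_card_ge_box_count:
  fixes A :: "'a::euclidean_space set"
  assumes "bounded A" "0 < \<delta>"
  obtains X where "finite X" "X \<subseteq> A" "separated \<delta> X" "box_count (2 * \<delta>) A \<le> card X"
proof -
  obtain X where X: "finite X" "X \<subseteq> A" "separated \<delta> X" "A \<subseteq> (\<Union>x\<in>X. ball x \<delta>)"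
    using maximal_separated_exists[OF assms] .
  define S where "S = (\<lambda>x. x - \<delta> *\<^sub>R One) ` X"
  have "A \<subseteq> (\<Union>a\<in>S. cbox a (a + (2 * \<delta>) *\<^sub>R One))"
  proof
    fix y assume "y \<in> A"
    then obtain x where x: "x \<in> X" "dist x y < \<delta>"
      using X(4) by auto
    have "y \<in> cbox (x - \<delta> *\<^sub>R One) (x - \<delta> *\<^sub>R One + (2 * \<delta>) *\<^sub>R One)"
    proof (unfold mem_box, rule ballI)
      fix i :: 'a assume i: "i \<in> Basis"
      have "\<bar>x \<bullet> i - y \<bullet> i\<bar> < \<delta>"
        using Basis_le_norm[OF i, of "x - y"] x(2) by (simp add: dist_norm inner_diff_left)
      moreover have "(x - \<delta> *\<^sub>R One) \<bullet> i = x \<bullet> i - \<delta>"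
        "(x - \<delta> *\<^sub>R One + (2 * \<delta>) *\<^sub>R One) \<bullet> i = x \<bullet> i + \<delta>"
        using i by (simp_all add: inner_diff_left inner_add_left)
      ultimately show "(x - \<delta> *\<^sub>R One) \<bullet> i \<le> y \<bullet> i \<and> y \<bullet> i \<le> (x - \<delta> *\<^sub>R One + (2 * \<delta>) *\<^sub>R One) \<bullet> i"
        unfolding abs_less_iff by auto
    qed
    then show "y \<in> (\<Union>a\<in>S. cbox a (a + (2 * \<delta>) *\<^sub>R One))"
      using x(1) by (auto simp: S_def)
  qed
  then have "box_count (2 * \<delta>) A \<le> card S"
    using X(1) by (intro box_count_le) (auto simp: S_def)
  also have "\<dots> \<le> card X"
    unfolding S_def using X(1) by (rule card_image_le)
  finally show ?thesis using that X by blast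
qed

section \<open>Tails of the cover time\<close>

lemma separated_scale: "0 \<le> c \<Longrightarrow> separated \<delta> X \<Longrightarrow> separated (c * \<delta>) ((\<lambda>x. c *\<^sub>R x) ` X)"
  for X :: "'a::real_normed_vector set"
  unfolding separated_def
  by (auto simp: dist_norm mult_left_mono simp flip: scaleR_diff_right)

section \<open>Pair correlations summed over a separated set\<close>

context invariant_lines
begin

text \<open>Up to distance 1 the linear gap yields exponential decay, from 1 to \<open>S\<close> the
  gap is at least 1 / 96, and beyond \<open>S\<close> the far bound applies. The three bounds are
  added so that each can be summed over all points on its own. The rate \<open>a\<close> per unit of
  \<open>\<delta>\<close> puts the near term into the form of
  \<open>separated_exp_sum\<close>.\<close>

lemma exp_both_le:
  assumes t: "0 < t" and S: "0 < S" and a: "0 < \<delta>" "a \<le> t * \<delta> / 96"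
  shows "exp (t * both x y) \<le> exp t * exp (- a * (dist x y / \<delta>))
    + (if dist x y \<le> S then exp (t - t / 96) else 0) + exp (9 * t / S)"
proof -
  consider "dist x y \<le> 1" | "1 < dist x y" "dist x y \<le> S" | "S < dist x y"
    by linarith
  then show ?thesis
  proof cases
    case 1
    have "a * (dist x y / \<delta>) \<le> t * \<delta> / 96 * (dist x y / \<delta>)"
      using a by (intro mult_right_mono) auto
    also have "\<dots> = t * (dist x y / 96)"
      using a(1) by (simp add: field_simps)
    finally have "a * (dist x y / \<delta>) \<le> t * (dist x y / 96)" .
    moreover have "t * both x y \<le> t * (1 - dist x y / 96)"
      using both_le_gap[of x y] 1 t by (intro mult_left_mono) (auto simp: min_def split: if_splits)
    ultimately have "t * both x y \<le> t - a * (dist x y / \<delta>)"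
      using right_diff_distrib[of t 1 "dist x y / 96"] by linarith
    then have "exp (t * both x y) \<le> exp t * exp (- a * (dist x y / \<delta>))"
      by (simp flip: exp_add)
    then show ?thesis
      by (simp add: add_increasing2)
  next
    case 2
    have "t * both x y \<le> t * (1 - 1 / 96)"
      using both_le_gap[of x y] 2 t by (intro mult_left_mono) auto
    then have "exp (t * both x y) \<le> exp (t - t / 96)"
      by (simp add: algebra_simps)
    then show ?thesis
      using 2 by (simp add: add_increasing add_increasing2)
  next
    case 3
    have "both x y \<le> 9 / dist x y"
      using both_le_inverse[of x y] 3 S by linarith
    also have "\<dots> \<le> 9 / S"
      using 3 S by (intro frac_le) auto
    finally have "t * both x y \<le> t * (9 / S)"
      using t by (intro mult_left_mono) auto
    then have "exp (t * both x y) \<le> exp (9 * t / S)"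
      by (simp add: mult.commute)
    then show ?thesis
      using 3 by (simp add: add_increasing)
  qed
qed

lemma sum_exp_both_le:
  assumes Y: "finite Y" "separated \<delta> Y" and t: "0 < t" and S: "0 < S" and a: "0 < \<delta>" "a \<le> t * \<delta> / 96"
    and C: "\<And>x. (\<Sum>y\<in>Y. exp (- a * (dist x y / \<delta>))) \<le> C"
  shows "(\<Sum>x\<in>Y. \<Sum>y\<in>Y. exp (t * both x y)) \<le> real (card Y) * (exp t * C
    + (2 * S / \<delta> + 1) ^ DIM('a) * exp (t - t / 96) + real (card Y) * exp (9 * t / S))"
proof -
  have "(\<Sum>y\<in>Y. exp (t * both x y)) \<le> exp t * C
    + (2 * S / \<delta> + 1) ^ DIM('a) * exp (t - t / 96) + real (card Y) * exp (9 * t / S)" for x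
  proof -
    have "real (card {y \<in> Y. dist x y \<le> S}) \<le> (2 * S / \<delta> + 1) ^ DIM('a)"
      using Y S a(1) by (intro card_separated_le[of _ _ x]) (auto simp: separated_def)
    then have "real (card {y \<in> Y. dist x y \<le> S}) * exp (t - t / 96)
        \<le> (2 * S / \<delta> + 1) ^ DIM('a) * exp (t - t / 96)"
      by (intro mult_right_mono) auto
    moreover have "(\<Sum>y\<in>Y. if dist x y \<le> S then exp (t - t / 96) else 0)
        = real (card {y \<in> Y. dist x y \<le> S}) * exp (t - t / 96)"
      using Y(1) by (simp add: sum.If_cases Int_def)
    moreover have "exp t * (\<Sum>y\<in>Y. exp (- a * (dist x y / \<delta>))) \<le> exp t * C"
      using C by (intro mult_left_mono) auto
    moreover have "(\<Sum>y\<in>Y. exp (t * both x y)) \<le> (\<Sum>y\<in>Y. exp t * exp (- a * (dist x y / \<delta>))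
        + (if dist x y \<le> S then exp (t - t / 96) else 0) + exp (9 * t / S))"
      by (intro sum_mono exp_both_le t S a)
    moreover have "\<dots> = exp t * (\<Sum>y\<in>Y. exp (- a * (dist x y / \<delta>)))
        + (\<Sum>y\<in>Y. if dist x y \<le> S then exp (t - t / 96) else 0) + real (card Y) * exp (9 * t / S)"
      by (simp add: sum.distrib sum_distrib_left)
    ultimately show ?thesis by linarith
  qed
  then show ?thesis
    by (intro sum_bounded_above)
qed

end

section \<open>Tails of the cover time along the dilates of \<open>A\<close>\<close>

context line_process
begin

text \<open>With \<open>\<epsilon>\<close> fixed so that shrunken balls still have measure at least
  1 / 2, the union bound over a finite net tends to 0 as time grows. Finiteness matters for the
  tails because \<open>real_of_ereal\<close> sends infinity to 0.\<close>

lemma cover_time_finite: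
  assumes "bounded A"
  shows "AE \<omega> in P. cover_time (\<Psi> \<omega>) A < \<infinity>"
proof -
  obtain C where C: "0 < C" "\<And>\<epsilon> x. 0 < \<epsilon> \<Longrightarrow> \<epsilon> \<le> 1 / 2 \<Longrightarrow> 1 - C * \<epsilon> \<le> measure \<mu> (hitting x (1 - \<epsilon>))"
    using measure_hitting_ge by blast
  define \<epsilon> where "\<epsilon> = min (1 / 2) (1 / (2 * C))"
  have \<epsilon>: "0 < \<epsilon>" "\<epsilon> \<le> 1 / 2" using C(1) by (auto simp: \<epsilon>_def)
  have "C * \<epsilon> \<le> C * (1 / (2 * C))"
    using C(1) by (intro mult_left_mono) (auto simp: \<epsilon>_def)
  then have c: "1 / 2 \<le> measure \<mu> (hitting x (1 - \<epsilon>))" for x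
    using C(2)[OF \<epsilon>, of x] C(1) by simp
  obtain U where U: "finite U" "A \<subseteq> (\<Union>u\<in>U. ball u \<epsilon>)"
    using bounded_finite_net[OF assms \<epsilon>(1)] .
  then have U': "A \<subseteq> (\<Union>u\<in>U. cball u \<epsilon>)"
    using ball_subset_cball by blast
  have m: "(\<lambda>\<omega>. cover_time (\<Psi> \<omega>) A) \<in> borel_measurable P"
    using assms by (rule cover_time_measurable)
  have "prob {\<omega> \<in> space P. cover_time (\<Psi> \<omega>) A = \<infinity>} \<le> card U * exp (- real (Suc k) * (1 / 2))" for k
  proof -
    have "prob {\<omega> \<in> space P. cover_time (\<Psi> \<omega>) A = \<infinity>}
       \<le> prob {\<omega> \<in> space P. ereal (real (Suc k)) < cover_time (\<Psi> \<omega>) A}"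
      using m by (intro finite_measure_mono) auto
    also have "\<dots> \<le> card U * exp (- real (Suc k) * (1 / 2))"
      using U(1) U' c by (intro prob_cover_time_gt[where \<epsilon>=\<epsilon>]) auto
    finally show ?thesis .
  qed
  moreover have "(\<lambda>k. real (card U) * exp (- real (Suc k) * (1 / 2))) \<longlonglongrightarrow> 0"
    by real_asymp
  ultimately have "prob {\<omega> \<in> space P. cover_time (\<Psi> \<omega>) A = \<infinity>} \<le> 0"
    by (intro LIMSEQ_le_const[where X="\<lambda>k. real (card U) * exp (- real (Suc k) * (1 / 2))"]) auto
  then have "prob {\<omega> \<in> space P. cover_time (\<Psi> \<omega>) A = \<infinity>} = 0"
    by (simp add: measure_le_0_iff)
  then have "AE \<omega> in P. \<not> cover_time (\<Psi> \<omega>) A = \<infinity>"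
    using m by (subst (asm) prob_eq_0) (auto simp: )
  then show ?thesis by eventually_elim auto
qed

text \<open>With l = ln n, boxes of side 1 / (n l) for \<open>A\<close> become boxes of side 1 / l
  for n A, at most c exp (D (l + ln l)) in number. At time t = D (l + ln l) + K the union bound is c
  exp (- K) times the price exp (C \<epsilon> t) of shrinking by \<epsilon> = d / l. The part of C
  \<epsilon> t without K is at most 2 D C d, and the part with K is at most K / 2. This leaves
  \<open>exp (- K / 2)\<close>, with one threshold for n that serves all K.\<close>

lemma upper_tail:
  assumes A: "bounded A" and D: "0 \<le> D"
    and box: "\<forall>\<^sub>F \<delta> in at_right 0. real (box_count \<delta> A) \<le> c * \<delta> powr - D" 
  obtains C where "\<forall>\<^sub>F n in sequentially. \<forall>K>0. prob {\<omega> \<in> space P.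
     ereal (D * (ln (real n) + ln (ln (real n))) + K) < cover_time (\<Psi> \<omega>) ((\<lambda>x. real n *\<^sub>R x) ` A)} \<le> C * exp (- K / 2)"
proof -
  obtain C where C: "0 < C" "\<And>\<epsilon> x. 0 < \<epsilon> \<Longrightarrow> \<epsilon> \<le> 1 / 2 \<Longrightarrow> 1 - C * \<epsilon> \<le> measure \<mu> (hitting x (1 - \<epsilon>))"
    using measure_hitting_ge by blast
  define d where "d = real DIM('a)"
  have d: "0 < d" by (simp add: d_def)
  have lim: "filterlim (\<lambda>n. 1 / (real n * ln (real n))) (at_right 0) sequentially"
    by real_asymp
  have ev: "\<forall>\<^sub>F n in sequentially. real (box_count (1 / (real n * ln (real n))) A)
      \<le> c * (1 / (real n * ln (real n))) powr - D"
    by (rule eventually_compose_filterlim[OF box lim])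
  have big: "\<forall>\<^sub>F n in sequentially. B \<le> ln (real n)" for B
    by real_asymp
  have "\<forall>\<^sub>F n in sequentially. \<forall>K>0. prob {\<omega> \<in> space P.
     ereal (D * (ln (real n) + ln (ln (real n))) + K) < cover_time (\<Psi> \<omega>) ((\<lambda>x. real n *\<^sub>R x) ` A)}
     \<le> c * exp (2 * D * C * d) * exp (- K / 2)"
    using ev big[of 2] big[of "2 * d"] big[of "2 * C * d"]
  proof eventually_elim
    case (elim n)
    define l where "l = ln (real n)"
    have l: "2 \<le> l" "2 * d \<le> l" "2 * C * d \<le> l"
      using elim by (auto simp: l_def)
    have n: "0 < real n"
      using l(1) by (cases n) (auto simp: l_def)
    define \<delta> where "\<delta> = 1 / (real n * l)"
    have \<delta>: "0 < \<delta>" using n l by (simp add: \<delta>_def)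
    define \<epsilon> where "\<epsilon> = d / l"
    have \<epsilon>: "0 < \<epsilon>" "\<epsilon> \<le> 1 / 2" "real n * (\<delta> * d) = \<epsilon>" "C * \<epsilon> \<le> 1 / 2"
      using l d n by (auto simp: \<epsilon>_def \<delta>_def field_simps)
    obtain S where S: "finite S" "card S = box_count \<delta> A" "A \<subseteq> (\<Union>a\<in>S. cbox a (a + \<delta> *\<^sub>R One))"
      using box_cover_exists[OF A \<delta>] .
    define S' where "S' = (\<lambda>x. real n *\<^sub>R x) ` S"
    have S': "(\<lambda>x. real n *\<^sub>R x) ` A \<subseteq> (\<Union>a\<in>S'. cball a \<epsilon>)"
    proof safe
      fix x assume "x \<in> A"
      then obtain a where a: "a \<in> S" "x \<in> cball a (\<delta> * d)"
      proof -
        obtain a where "a \<in> S" "x \<in> cbox a (a + \<delta> *\<^sub>R One)"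
          using S(3) \<open>x \<in> A\<close> by blast
        then show ?thesis
          using that[of a] cbox_subset_cball[of \<delta> a] \<delta> by (auto simp: d_def)
      qed
      have "dist (real n *\<^sub>R a) (real n *\<^sub>R x) = real n * dist a x"
        by (simp add: dist_norm flip: scaleR_diff_right)
      also have "\<dots> \<le> real n * (\<delta> * d)"
        using a(2) by (intro mult_left_mono) auto
      finally show "real n *\<^sub>R x \<in> (\<Union>a\<in>S'. cball a \<epsilon>)"
        using a(1) \<epsilon>(3) by (auto simp: S'_def)
    qed
    have ll: "0 \<le> ln l" "ln l \<le> l"
      using l ln_bound[of l] by auto
    have "real (card S') \<le> real (card S)"
      unfolding S'_def using S(1) by (simp add: card_image_le)
    also have "\<dots> \<le> c * \<delta> powr - D"
      using elim(1) by (simp add: S(2) \<delta>_def l_def)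
    also have "\<delta> powr - D = exp (D * (l + ln l))"
    proof -
      have "ln \<delta> = - (l + ln l)"
        using n l by (simp add: \<delta>_def ln_div ln_mult) (simp add: l_def)
      then have "- D * ln \<delta> = D * (l + ln l)"
        using minus_mult_minus[of D "l + ln l"] by metis
      then show ?thesis
        using \<delta> by (simp add: powr_def)
    qed
    finally have card: "real (card S') \<le> c * exp (D * (l + ln l))" .
    \<comment> \<open>The sign of \<open>c\<close> is not assumed; it follows because
      \<open>c\<close> times a positive number bounds a cardinality.\<close>
    have c: "0 \<le> c"
    proof (rule ccontr)
      assume "\<not> 0 \<le> c"
      then have "c * exp (D * (l + ln l)) < 0" by (simp add: mult_neg_pos)
      then show False using card by linarith
    qed
    show ?case
    proof (intro allI impI)
      fix K :: real assume K: "0 < K"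
      define t where "t = D * (l + ln l) + K"
      show "prob {\<omega> \<in> space P. ereal (D * (ln (real n) + ln (ln (real n))) + K)
            < cover_time (\<Psi> \<omega>) ((\<lambda>x. real n *\<^sub>R x) ` A)}
        \<le> c * exp (2 * D * C * d) * exp (- K / 2)"
      proof -
        have Dl: "0 \<le> D * (l + ln l)"
          using D l ll by simp
        then have t: "0 < t"
          using K by (simp add: t_def)
        have "(l + ln l) * \<epsilon> \<le> (2 * l) * \<epsilon>"
          using ll \<epsilon>(1) by (intro mult_right_mono) auto
        also have "\<dots> = 2 * d"
          using l by (simp add: \<epsilon>_def)
        finally have "(D * C) * ((l + ln l) * \<epsilon>) \<le> (D * C) * (2 * d)"
          using D C(1) by (intro mult_left_mono) auto
        moreover have "K * (C * \<epsilon>) \<le> K * (1 / 2)"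
          using K \<epsilon>(4) by (intro mult_left_mono) auto
        ultimately have expo: "D * (l + ln l) + - t * (1 - C * \<epsilon>) \<le> 2 * D * C * d + - K / 2"
          by (simp add: t_def algebra_simps)
        have "prob {\<omega> \<in> space P. ereal t < cover_time (\<Psi> \<omega>) ((\<lambda>x. real n *\<^sub>R x) ` A)}
            \<le> card S' * exp (- t * (1 - C * \<epsilon>))"
          using S' S(1) t C(2)[OF \<epsilon>(1,2)] by (intro prob_cover_time_gt) (auto simp: S'_def)
        also have "\<dots> \<le> c * exp (D * (l + ln l)) * exp (- t * (1 - C * \<epsilon>))"
          using card by (intro mult_right_mono) auto
        also have "\<dots> = c * exp (D * (l + ln l) + - t * (1 - C * \<epsilon>))"
          by (simp only: exp_add mult.assoc)
        also have "\<dots> \<le> c * exp (2 * D * C * d + - K / 2)"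
          using c expo by (intro mult_left_mono) auto
        also have "\<dots> = c * exp (2 * D * C * d) * exp (- K / 2)"
          by (simp only: exp_add mult.assoc)
        finally show ?thesis
          by (simp add: t_def l_def)
      qed
    qed
  qed
  then show ?thesis by (rule that)
qed

text \<open>The second moment bound is applied with separation 1 / l and far distance l ^ 2, where l
  = ln n. Near and middle pairs contribute a constant times exp t / m, which is of order exp (- K)
  because m is at least a constant times exp (t + K). The far pairs contribute exp (9 t / l ^ 2) -
  1, which vanishes as n grows and is what \<open>\<eta>\<close> absorbs.\<close>

lemma lower_tail_pos:
  assumes A: "bounded A" and D: "0 < D" and c: "0 < c"
    and box: "\<forall>\<^sub>F \<delta> in at_right 0. c * \<delta> powr - D \<le> real (box_count \<delta> A)"
  obtains C where "\<And>K \<eta>. 0 < K \<Longrightarrow> 0 < \<eta> \<Longrightarrow> \<forall>\<^sub>F n in sequentially. prob {\<omega> \<in> space P.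
     cover_time (\<Psi> \<omega>) ((\<lambda>x. real n *\<^sub>R x) ` A) < ereal (D * (ln (real n) + ln (ln (real n))) - K)}
       \<le> C * exp (- K) + \<eta>"
proof -
  \<comment> \<open>Once t is at least D l / 2, the separation 1 / l gives t (1 / l) / 96 at least D
    / 192. The rate thus stays fixed while n grows.\<close>
  define a where "a = D / 192"
  have a: "0 < a" using D by (simp add: a_def)
  define Ca where "Ca = (4 / a) ^ DIM('a) * fact DIM('a) * exp (3 * a / 4) / (1 - exp (- a / 2))"
  have Ca: "0 \<le> Ca" using a by (simp add: Ca_def)
  \<comment> \<open>The factor \<open>2 powr - D\<close> accounts for the boxes of side
    \<open>2 * \<delta>\<close> in \<open>separated_card_ge_box_count\<close>.\<close>
  define c' where "c' = c * 2 powr - D"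
  have c': "0 < c'" using c by (simp add: c'_def)
  have lim: "filterlim (\<lambda>n. 2 * (1 / (real n * ln (real n)))) (at_right 0) sequentially"
    by real_asymp
  have ev: "\<forall>\<^sub>F n in sequentially. c * (2 * (1 / (real n * ln (real n)))) powr - D
      \<le> real (box_count (2 * (1 / (real n * ln (real n)))) A)"
    by (rule eventually_compose_filterlim[OF box lim])
  have big: "\<forall>\<^sub>F n in sequentially. B \<le> ln (real n)" for B
    by real_asymp
  \<comment> \<open>The power is the packing bound for 1 / l-separated neighbours within distance l
    ^ 2. It is polynomial in l, so the gain exp (- t / 96), at most exp (- a l), outweighs
    it.\<close>
  have "((\<lambda>l::real. (2 * l ^ 2 / (1 / l) + 1) ^ DIM('a) * exp (- a * l)) \<longlongrightarrow> 0) at_top"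
    using a by real_asymp
  moreover have "filterlim (\<lambda>n. ln (real n)) at_top sequentially"
    by real_asymp
  ultimately have "((\<lambda>n. (2 * ln (real n) ^ 2 / (1 / ln (real n)) + 1) ^ DIM('a) * exp (- a * ln (real n))) \<longlongrightarrow> 0) sequentially"
    by (rule filterlim_compose)
  then have ev2: "\<forall>\<^sub>F n in sequentially. (2 * ln (real n) ^ 2 / (1 / ln (real n)) + 1) ^ DIM('a) * exp (- a * ln (real n)) < 1"
    by (rule order_tendstoD) simp
  have "\<forall>\<^sub>F n in sequentially. prob {\<omega> \<in> space P.
     cover_time (\<Psi> \<omega>) ((\<lambda>x. real n *\<^sub>R x) ` A) < ereal (D * (ln (real n) + ln (ln (real n))) - K)}
       \<le> (Ca + 1) / c' * exp (- K) + \<eta>" if K: "0 < K" and \<eta>: "0 < \<eta>" for K \<eta>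
  proof -
    have "((\<lambda>n. exp (18 * D / ln (real n)) - 1) \<longlongrightarrow> 0) sequentially"
      by real_asymp
    then have ev3: "\<forall>\<^sub>F n in sequentially. exp (18 * D / ln (real n)) - 1 < \<eta>"
      using \<eta> by (rule order_tendstoD)
    show ?thesis
      using ev ev2 ev3 big[of 2] big[of "2 * K / D"]
    proof eventually_elim
      case (elim n)
      define l where "l = ln (real n)"
      have l: "2 \<le> l" "2 * K / D \<le> l"
        using elim by (auto simp: l_def)
      have n: "0 < real n"
        using l(1) by (cases n) (auto simp: l_def)
      define \<delta> where "\<delta> = 1 / (real n * l)"
      have \<delta>: "0 < \<delta>" "real n * \<delta> = 1 / l" using n l by (auto simp: \<delta>_def)
      have ll: "0 \<le> ln l" "ln l \<le> l"
        using l ln_bound[of l] by auto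
      define t where "t = D * (l + ln l) - K"
      \<comment> \<open>The threshold for n depends on \<open>K\<close>, so that the shift by
        \<open>K\<close> costs at most half of \<open>D * l\<close>. Together with
        \<open>ln l \<le> l\<close> this confines \<open>t\<close> to a fixed ratio of
        \<open>D * l\<close>.\<close>
      have "K \<le> D * l / 2"
        using l(2) D by (simp add: field_simps)
      moreover have "0 \<le> D * ln l" "D * ln l \<le> D * l"
        using D ll by (auto intro: mult_left_mono)
      ultimately have t2: "D * l / 2 \<le> t" "t \<le> 2 * D * l"
        using K unfolding t_def by (simp_all add: algebra_simps)
      moreover have "0 < D * l" using D l by simp
      ultimately have t: "0 < t" by linarith
      obtain X where X: "finite X" "X \<subseteq> A" "separated \<delta> X" "box_count (2 * \<delta>) A \<le> card X"
        using separated_card_ge_box_count[OF A \<delta>(1)] .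
      define Y where "Y = (\<lambda>x. real n *\<^sub>R x) ` X"
      define m where "m = real (card Y)"
      have cardY: "card Y = card X"
        unfolding Y_def using n by (intro card_image) (auto simp: inj_on_def)
      have "(2 * \<delta>) powr - D = 2 powr - D * exp (D * (l + ln l))"
      proof -
        have "ln \<delta> = - (l + ln l)"
          using n l by (simp add: \<delta>_def ln_div ln_mult) (simp add: l_def)
        then have "- D * ln \<delta> = D * (l + ln l)"
          using minus_mult_minus[of D "l + ln l"] by metis
        then have "\<delta> powr - D = exp (D * (l + ln l))"
          using \<delta>(1) by (simp add: powr_def)
        then show ?thesis
          using \<delta>(1) by (simp add: powr_mult)
      qed
      then have "c' * exp (D * (l + ln l)) \<le> real (box_count (2 * \<delta>) A)"
        using elim(1) by (simp add: c'_def \<delta>_def l_def mult.assoc)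
      also have "\<dots> \<le> m"
        using X(4) by (simp add: m_def cardY)
      finally have m: "c' * exp (D * (l + ln l)) \<le> m" .
      then have m0: "0 < m"
        using c' by (smt (verit) exp_gt_zero mult_pos_pos)
      have sepY: "separated (1 / l) Y"
        using separated_scale[OF _ X(3), of "real n"] \<delta>(2) by (simp add: Y_def)
      have Yfin: "finite Y" "Y \<noteq> {}" "Y \<subseteq> (\<lambda>x. real n *\<^sub>R x) ` A"
        using X m0 by (auto simp: Y_def m_def)
      define B where "B = (2 * l ^ 2 / (1 / l) + 1) ^ DIM('a)"
      have B: "0 \<le> B" "B * exp (- a * l) \<le> 1"
        using elim(2) l by (auto simp: B_def l_def)
      have sum: "(\<Sum>x\<in>Y. \<Sum>y\<in>Y. exp (t * both x y))
          \<le> m * (exp t * Ca + B * exp (t - t / 96) + m * exp (9 * t / l ^ 2))"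
        unfolding m_def B_def
      proof (rule sum_exp_both_le)
        show "a \<le> t * (1 / l) / 96"
          using t2(1) l by (simp add: a_def field_simps)
        show "(\<Sum>y\<in>Y. exp (- a * (dist x y / (1 / l)))) \<le> Ca" for x
          unfolding Ca_def using l by (intro separated_exp_sum Yfin sepY a) auto
      qed (use Yfin sepY t l in auto)
      have "prob {\<omega> \<in> space P. cover_time (\<Psi> \<omega>) ((\<lambda>x. real n *\<^sub>R x) ` A) < ereal t}
         \<le> (\<Sum>x\<in>Y. \<Sum>y\<in>Y. exp (t * both x y)) / m\<^sup>2 - 1"
        unfolding m_def by (rule prob_cover_time_less[OF Yfin t])
      also have "\<dots> \<le> m * (exp t * Ca + B * exp (t - t / 96) + m * exp (9 * t / l ^ 2)) / m\<^sup>2 - 1"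
        using sum m0 by (simp add: divide_right_mono)
      also have "\<dots> = exp t / m * (Ca + B * exp (- t / 96)) + (exp (9 * t / l ^ 2) - 1)"
      proof -
        have "exp (t - t / 96) = exp t * exp (- t / 96)"
          by (simp flip: exp_add)
        then show ?thesis
          using m0 by (simp add: divide_simps power2_eq_square) (simp add: algebra_simps)
      qed
      also have "\<dots> \<le> exp (- K) / c' * (Ca + 1) + \<eta>"
      proof (intro add_mono mult_mono)
        have "exp t / m \<le> exp t / (c' * exp (D * (l + ln l)))"
          using m m0 c' by (intro divide_left_mono) auto
        also have "\<dots> = exp (- K) / c'"
          using c' by (simp add: t_def exp_diff exp_minus field_simps)
        finally show "exp t / m \<le> exp (- K) / c'" .
        have "B * exp (- t / 96) \<le> B * exp (- a * l)"
          using B(1) t2(1) by (intro mult_left_mono) (auto simp: a_def)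
        then show "B * exp (- t / 96) \<le> 1"
          using B(2) by linarith
        have "9 * t / l ^ 2 \<le> 9 * (2 * D * l) / l ^ 2"
          using t2(2) by (intro divide_right_mono) auto
        also have "\<dots> = 18 * D / l"
          using l by (simp add: power2_eq_square)
        finally have "exp (9 * t / l ^ 2) \<le> exp (18 * D / l)"
          by simp
        then show "exp (9 * t / l ^ 2) - 1 \<le> \<eta>"
          using elim(3) unfolding l_def by linarith
      qed (use Ca B c' in auto)
      finally show ?case
        by (simp add: t_def l_def mult.commute)
    qed
  qed
  then show ?thesis by (rule that)
qed

text \<open>For D = 0 the threshold is \<open>- K\<close>, which lies below every cover time, so the
  event is empty. This case is separate because the second moment argument lets \<open>t\<close>
  grow with n.\<close>

lemma lower_tail:
  assumes A: "bounded A" and D: "0 \<le> D" and c: "0 < c"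
    and box: "\<forall>\<^sub>F \<delta> in at_right 0. c * \<delta> powr - D \<le> real (box_count \<delta> A)"
  obtains C where "\<And>K \<eta>. 0 < K \<Longrightarrow> 0 < \<eta> \<Longrightarrow> \<forall>\<^sub>F n in sequentially. prob {\<omega> \<in> space P.
     cover_time (\<Psi> \<omega>) ((\<lambda>x. real n *\<^sub>R x) ` A) < ereal (D * (ln (real n) + ln (ln (real n))) - K)}
       \<le> C * exp (- K) + \<eta>"
proof (cases "D = 0")
  case True
  have "\<not> cover_time \<psi> B < ereal (- K)" if "0 < K" for \<psi> :: "('a set \<times> real) set" and B K
  proof -
    have "ereal (- K) < 0" using that by simp
    also have "0 \<le> cover_time \<psi> B" by (rule cover_time_nonneg)
    finally show ?thesis by simp
  qed
  then show ?thesis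
    using True that[of 0] by simp
next
  case False
  with D have "0 < D" by simp
  show ?thesis
    by (rule lower_tail_pos[OF A \<open>0 < D\<close> c box], rule that)
qed

end

section \<open>Tightness from eventual bounds\<close>

lemma real_distribution_tight:
  assumes "real_distribution M" "0 < \<epsilon>"
  obtains a b where "a < b" "1 - \<epsilon> < measure M {a<..b}"
proof -
  interpret real_distribution M by fact
  have "(\<Union>n::nat. {- real n<..real n}) = UNIV"
  proof safe
    fix x :: real
    obtain n :: nat where "\<bar>x\<bar> < real n" using reals_Archimedean2 by blast
    then show "x \<in> (\<Union>n::nat. {- real n<..real n})"
      by (intro UN_I[of n]) auto
  qed simp
  moreover have "(\<lambda>n. measure M {- real n<..real n}) \<longlonglongrightarrow> measure M (\<Union>n::nat. {- real n<..real n})"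
    by (intro finite_Lim_measure_incseq) (auto simp: incseq_def)
  ultimately have "(\<lambda>n. measure M {- real n<..real n}) \<longlonglongrightarrow> 1"
    using prob_space by simp
  then have "\<forall>\<^sub>F n in sequentially. 1 - \<epsilon> < measure M {- real n<..real n}"
    using assms(2) by (intro order_tendstoD) auto
  then have "\<forall>\<^sub>F n in sequentially. 0 < n \<and> 1 - \<epsilon> < measure M {- real n<..real n}"
    using eventually_gt_at_top[of 0] by eventually_elim simp
  then obtain n :: nat where "0 < n" "1 - \<epsilon> < measure M {- real n<..real n}"
    using eventually_happens'[OF sequentially_bot] by blast
  then show ?thesis
    by (intro that[of "- real n" "real n"]) auto
qed

text \<open>Every single law is tight, so the finitely many early indices are absorbed by enlarging
  the interval.\<close>

lemma tightI_eventually: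
  assumes dist: "\<And>n. real_distribution (M n)"
    and ev: "\<And>\<epsilon>. 0 < \<epsilon> \<Longrightarrow> \<exists>a b. \<forall>\<^sub>F n in sequentially. 1 - \<epsilon> < measure (M n) {a<..b}"
  shows "tight M"
  unfolding tight_def
proof (intro conjI allI impI dist)
  fix \<epsilon> :: real assume \<epsilon>: "0 < \<epsilon>"
  obtain a b N where N: "\<And>n. N \<le> n \<Longrightarrow> 1 - \<epsilon> < measure (M n) {a<..b}"
    using ev[OF \<epsilon>] unfolding eventually_sequentially by blast
  have "\<exists>a b. a < b \<and> 1 - \<epsilon> < measure (M n) {a<..b}" for n
    using real_distribution_tight[OF dist \<epsilon>] by metis
  then obtain a' b' where ab: "\<And>n. a' n < b' n" "\<And>n. 1 - \<epsilon> < measure (M n) {a' n<..b' n}"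
    by metis
  define \<alpha> where "\<alpha> = Min (insert a (a' ` {..N}))"
  define \<beta> where "\<beta> = Max (insert b (b' ` {..N}))"
  have le: "\<alpha> \<le> a" "b \<le> \<beta>" "\<And>n. n \<le> N \<Longrightarrow> \<alpha> \<le> a' n" "\<And>n. n \<le> N \<Longrightarrow> b' n \<le> \<beta>"
    unfolding \<alpha>_def \<beta>_def by (intro Min_le Max_ge; simp)+
  have "\<alpha> < \<beta>"
    using le(3)[of 0] le(4)[of 0] ab(1)[of 0] by simp
  moreover have "1 - \<epsilon> < measure (M n) {\<alpha><..\<beta>}" for n
  proof -
    interpret real_distribution "M n" by (rule dist)
    have mono: "measure (M n) {x<..y} \<le> measure (M n) {\<alpha><..\<beta>}" if "\<alpha> \<le> x" "y \<le> \<beta>" for x y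
      using that by (intro finite_measure_mono) auto
    show ?thesis
    proof (cases "N \<le> n")
      case True
      then show ?thesis using N[OF True] mono[OF le(1,2)] by simp
    next
      case False
      then have "n \<le> N" by simp
      then show ?thesis using ab(2)[of n] mono[OF le(3)[of n] le(4)[of n]] by simp
    qed
  qed
  ultimately show "\<exists>a b. a < b \<and> (\<forall>n. 1 - \<epsilon> < measure (M n) {a<..b})"
    by blast
qed

text \<open>The strict inequalities leave room for real constants. For the sign of \<open>D\<close>:
  a positive liminf makes the count at least 1 for small \<open>\<delta>\<close>, and with
  \<open>D < 0\<close> the factor \<open>\<delta> powr D\<close> alone would then violate the finite
  limsup.\<close>

lemma box_count_bounds:
  assumes "0 < Liminf (at_right 0) (\<lambda>\<delta>. ereal (\<delta> powr D * real (box_count \<delta> A)))"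
    and "Limsup (at_right 0) (\<lambda>\<delta>. ereal (\<delta> powr D * real (box_count \<delta> A))) < \<infinity>"
  obtains c c' where "0 < c" "0 \<le> D"
    "\<forall>\<^sub>F \<delta> in at_right 0. c * \<delta> powr - D \<le> real (box_count \<delta> A)"
    "\<forall>\<^sub>F \<delta> in at_right 0. real (box_count \<delta> A) \<le> c' * \<delta> powr - D"
proof -
  obtain c where c: "0 < ereal c" "ereal c < Liminf (at_right 0) (\<lambda>\<delta>. ereal (\<delta> powr D * real (box_count \<delta> A)))"
    using ereal_dense2[OF assms(1)] by blast
  obtain c' where c': "Limsup (at_right 0) (\<lambda>\<delta>. ereal (\<delta> powr D * real (box_count \<delta> A))) < ereal c'"
    using ereal_dense2[OF assms(2)] by blast
  have lo: "\<forall>\<^sub>F \<delta> in at_right 0. c < \<delta> powr D * real (box_count \<delta> A)"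
    using less_LiminfD[OF c(2)] by simp
  have up: "\<forall>\<^sub>F \<delta> in at_right 0. \<delta> powr D * real (box_count \<delta> A) < c'"
    using Limsup_lessD[OF c'] by simp
  have pos: "\<forall>\<^sub>F \<delta> in at_right (0::real). 0 < \<delta>"
    by (rule eventually_at_right_less)
  have cc: "0 < c" using c(1) by simp
  have inv: "\<delta> powr - D * \<delta> powr D = 1" if "0 < \<delta>" for \<delta> :: real
    using that by (simp flip: powr_add)
  have "\<forall>\<^sub>F \<delta> in at_right 0. c * \<delta> powr - D \<le> real (box_count \<delta> A)"
    using lo pos
  proof eventually_elim
    case (elim \<delta>)
    have "\<delta> powr - D * c \<le> \<delta> powr - D * (\<delta> powr D * real (box_count \<delta> A))"
      using elim by (intro mult_left_mono) auto
    also have "\<dots> = real (box_count \<delta> A)"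
      using inv[of \<delta>] elim(2) by (simp flip: mult.assoc)
    finally show ?case by (simp add: mult.commute)
  qed
  moreover have "\<forall>\<^sub>F \<delta> in at_right 0. real (box_count \<delta> A) \<le> c' * \<delta> powr - D"
    using up pos
  proof eventually_elim
    case (elim \<delta>)
    have "real (box_count \<delta> A) = \<delta> powr - D * (\<delta> powr D * real (box_count \<delta> A))"
      using inv[of \<delta>] elim(2) by (simp flip: mult.assoc)
    also have "\<dots> \<le> \<delta> powr - D * c'"
      using elim by (intro mult_left_mono) auto
    finally show ?case by (simp add: mult.commute)
  qed
  moreover have "0 \<le> D"
  proof (rule ccontr)
    assume "\<not> 0 \<le> D"
    then have D: "D < 0" by simp
    have "filterlim (\<lambda>\<delta>. \<delta> powr D) at_top (at_right 0)"
      using D by real_asymp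
    then have "\<forall>\<^sub>F \<delta> in at_right 0. c' \<le> \<delta> powr D"
      by (simp add: filterlim_at_top)
    then have "\<forall>\<^sub>F \<delta> in at_right (0::real). False"
      using lo up
    proof eventually_elim
      case (elim \<delta>)
      have "box_count \<delta> A \<noteq> 0"
        using elim(2) cc by (intro notI) simp
      then have "1 \<le> real (box_count \<delta> A)"
        by simp
      then have "\<delta> powr D * 1 \<le> \<delta> powr D * real (box_count \<delta> A)"
        by (intro mult_left_mono) auto
      then show ?case using elim by simp
    qed
    then show False by simp
  qed
  ultimately show ?thesis using that cc by blast
qed

lemma (in line_process) tight_cover_time:
  assumes A: "bounded A" and D: "0 \<le> D" and c: "0 < c"
    and lo: "\<forall>\<^sub>F \<delta> in at_right 0. c * \<delta> powr - D \<le> real (box_count \<delta> A)"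
    and up: "\<forall>\<^sub>F \<delta> in at_right 0. real (box_count \<delta> A) \<le> c' * \<delta> powr - D"
  shows "tight (\<lambda>k. let n = k + 2 in distr P borel (\<lambda>\<omega>.
            real_of_ereal (cover_time (\<Psi> \<omega>) ((\<lambda>x. real n *\<^sub>R x) ` A))
              - D * (ln (real n) + ln (ln (real n)))))"
proof -
  define T where "T n \<omega> = cover_time (\<Psi> \<omega>) ((\<lambda>x. real n *\<^sub>R x) ` A)" for n \<omega>
  define s where "s n = D * (ln (real n) + ln (ln (real n)))" for n :: nat
  define X where "X n \<omega> = real_of_ereal (T n \<omega>) - s n" for n \<omega>
  have T [measurable]: "T n \<in> borel_measurable P" for n
    unfolding T_def using bounded_scaling[OF A] by (rule cover_time_measurable)
  have X [measurable]: "X n \<in> borel_measurable P" for n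
    unfolding X_def by measurable
  have fin: "AE \<omega> in P. T n \<omega> < \<infinity>" for n
    unfolding T_def using bounded_scaling[OF A] by (rule cover_time_finite)
  have T0: "0 \<le> T n \<omega>" for n \<omega>
    unfolding T_def by (rule cover_time_nonneg)
  obtain Cu where Cu: "\<forall>\<^sub>F n in sequentially. \<forall>K>0. prob {\<omega> \<in> space P. ereal (s n + K) < T n \<omega>} \<le> Cu * exp (- K / 2)"
    using upper_tail[OF A D up] unfolding T_def s_def by blast
  obtain Cl where Cl: "\<And>K \<eta>. 0 < K \<Longrightarrow> 0 < \<eta> \<Longrightarrow>
      \<forall>\<^sub>F n in sequentially. prob {\<omega> \<in> space P. T n \<omega> < ereal (s n - K)} \<le> Cl * exp (- K) + \<eta>"
    using lower_tail[OF A D c lo] unfolding T_def s_def by blast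
  have "tight (\<lambda>k. distr P borel (X (k + 2)))"
  proof (rule tightI_eventually)
    show "real_distribution (distr P borel (X (k + 2)))" for k
      by (intro real_distribution_distr) measurable
  next
    fix \<epsilon> :: real assume \<epsilon>: "0 < \<epsilon>"
    have "((\<lambda>K. Cu * exp (- K / 2)) \<longlongrightarrow> 0) at_top" "((\<lambda>K. Cl * exp (- K)) \<longlongrightarrow> 0) at_top"
      by real_asymp+
    then have "\<forall>\<^sub>F K in at_top. Cu * exp (- K / 2) < \<epsilon> / 4" "\<forall>\<^sub>F K in at_top. Cl * exp (- K) < \<epsilon> / 4"
      using \<epsilon> by (simp_all only: order_tendstoD(2) zero_less_divide_iff zero_less_numeral simp_thms)
    then have "\<forall>\<^sub>F K in at_top. Cu * exp (- K / 2) < \<epsilon> / 4 \<and> Cl * exp (- K) < \<epsilon> / 4 \<and> 0 < K"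
      using eventually_gt_at_top[of 0] by eventually_elim simp
    then obtain K where K: "Cu * exp (- K / 2) < \<epsilon> / 4" "Cl * exp (- K) < \<epsilon> / 4" "0 < K"
      using eventually_happens'[OF trivial_limit_at_top_linorder] by blast
    have low_ev: "\<forall>\<^sub>F n in sequentially. prob {\<omega> \<in> space P. T n \<omega> < ereal (s n - K)} \<le> Cl * exp (- K) + \<epsilon> / 4"
      using \<epsilon> by (intro Cl K(3)) simp
    have big: "\<forall>\<^sub>F n in sequentially. 1 \<le> ln (real n)"
      by real_asymp
    \<comment> \<open>The endpoint is \<open>- K - 1\<close> because the half-open interval leaves
      out the non-strict event \<open>X n \<omega> \<le> - K - 1\<close>, whereas the lower tail
      concerns a strict inequality.\<close>
    have "\<forall>\<^sub>F n in sequentially. 1 - \<epsilon> < measure (distr P borel (X n)) {- K - 1<..K}"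
      using Cu low_ev big
    proof eventually_elim
      case (elim n)
      have "0 \<le> ln (ln (real n))" using elim(3) by simp
      then have s0: "0 \<le> s n"
        using D elim(3) by (simp add: s_def)
      have hi: "prob {\<omega> \<in> space P. K < X n \<omega>} \<le> \<epsilon> / 4"
      proof -
        have "{\<omega> \<in> space P. K < X n \<omega>} \<subseteq> {\<omega> \<in> space P. ereal (s n + K) < T n \<omega>}"
        proof safe
          fix \<omega> assume "K < X n \<omega>"
          then have "s n + K < real_of_ereal (T n \<omega>)" by (simp add: X_def)
          then show "ereal (s n + K) < T n \<omega>"
            using s0 K(3) T0[of n \<omega>] by (cases "T n \<omega>") auto
        qed
        then have "prob {\<omega> \<in> space P. K < X n \<omega>} \<le> prob {\<omega> \<in> space P. ereal (s n + K) < T n \<omega>}"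
          by (intro finite_measure_mono) auto
        also have "\<dots> \<le> Cu * exp (- K / 2)"
          using elim(1) K(3) by blast
        finally show ?thesis using K(1) by simp
      qed
      have low: "prob {\<omega> \<in> space P. X n \<omega> \<le> - K - 1} \<le> \<epsilon> / 2"
      proof -
        \<comment> \<open>The inclusion holds only almost everywhere: an infinite cover time becomes
          0 under \<open>real_of_ereal\<close> and could pass for a very early one.\<close>
        have "AE \<omega> in P. \<omega> \<in> {\<omega> \<in> space P. X n \<omega> \<le> - K - 1} \<longrightarrow> \<omega> \<in> {\<omega> \<in> space P. T n \<omega> < ereal (s n - K)}"
          using fin[of n]
        proof eventually_elim
          case (elim \<omega>)
          then show ?case
            using T0[of n \<omega>] by (cases "T n \<omega>") (auto simp: X_def)
        qed
        then have "prob {\<omega> \<in> space P. X n \<omega> \<le> - K - 1} \<le> prob {\<omega> \<in> space P. T n \<omega> < ereal (s n - K)}"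
          by (intro finite_measure_mono_AE) auto
        also have "\<dots> \<le> Cl * exp (- K) + \<epsilon> / 4"
          using elim(2) by simp
        finally show ?thesis using K(2) by simp
      qed
      have "1 = prob ({\<omega> \<in> space P. X n \<omega> \<in> {- K - 1<..K}} \<union> ({\<omega> \<in> space P. K < X n \<omega>} \<union> {\<omega> \<in> space P. X n \<omega> \<le> - K - 1}))"
        by (subst prob_space[symmetric], rule arg_cong[where f=prob]) auto
      also have "\<dots> \<le> prob {\<omega> \<in> space P. X n \<omega> \<in> {- K - 1<..K}}
          + prob ({\<omega> \<in> space P. K < X n \<omega>} \<union> {\<omega> \<in> space P. X n \<omega> \<le> - K - 1})"
        by (intro measure_Un_le) auto
      also have "prob ({\<omega> \<in> space P. K < X n \<omega>} \<union> {\<omega> \<in> space P. X n \<omega> \<le> - K - 1})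
          \<le> prob {\<omega> \<in> space P. K < X n \<omega>} + prob {\<omega> \<in> space P. X n \<omega> \<le> - K - 1}"
        by (intro measure_Un_le) auto
      also have "prob {\<omega> \<in> space P. X n \<omega> \<in> {- K - 1<..K}} = measure (distr P borel (X n)) {- K - 1<..K}"
        by (subst measure_distr) (auto intro!: arg_cong[where f=prob])
      finally show ?case
        using hi low \<epsilon> by simp
    qed
    \<comment> \<open>The sequence starts at n = 2, where the inner logarithm is positive; the shift
      does not affect an eventual statement.\<close>
    then have "\<forall>\<^sub>F k in sequentially. 1 - \<epsilon> < measure (distr P borel (X (k + 2))) {- K - 1<..K}"
      by (rule eventually_compose_filterlim[OF _ filterlim_add_const_nat_at_top])
    then show "\<exists>a b. \<forall>\<^sub>F k in sequentially. 1 - \<epsilon> < measure (distr P borel (X (k + 2))) {a<..b}"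
      by blast
  qed
  then show ?thesis
    by (simp only: X_def [abs_def] T_def s_def Let_def)
qed

theorem theorem1p1:
  fixes A :: "'a::euclidean_space set"
    and \<mu> :: "'a set measure"
    and P :: "'w measure"
    and \<Psi> :: "'w \<Rightarrow> ('a set \<times> real) set"
  assumes "DIM('a) \<ge> 2"
    and "invariant_line_measure \<mu>"
    and "poisson_line_process P \<mu> \<Psi>"
    and "bounded A"
    and "\<exists>D. has_box_dim A D"
    and "0 < Liminf (at_right 0) (\<lambda>\<delta>. ereal (\<delta> powr box_dim A * real (box_count \<delta> A)))"
    and "Limsup (at_right 0) (\<lambda>\<delta>. ereal (\<delta> powr box_dim A * real (box_count \<delta> A))) < \<infinity>"
  shows "(\<forall>n::nat\<ge>2. (\<lambda>\<omega>. cover_time (\<Psi> \<omega>) ((\<lambda>x. real n *\<^sub>R x) ` A)) \<in> borel_measurable P \<and>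
            (AE \<omega> in P. cover_time (\<Psi> \<omega>) ((\<lambda>x. real n *\<^sub>R x) ` A) < \<infinity>)) \<and>
         tight (\<lambda>k. let n = k + 2 in distr P borel (\<lambda>\<omega>.
            real_of_ereal (cover_time (\<Psi> \<omega>) ((\<lambda>x. real n *\<^sub>R x) ` A))
              - box_dim A * (ln (real n) + ln (ln (real n)))))"
proof -
  interpret line_process \<mu> P \<Psi>
    using assms by unfold_locales auto
  obtain c c' where "0 < c" "0 \<le> box_dim A"
    "\<forall>\<^sub>F \<delta> in at_right 0. c * \<delta> powr - box_dim A \<le> real (box_count \<delta> A)"
    "\<forall>\<^sub>F \<delta> in at_right 0. real (box_count \<delta> A) \<le> c' * \<delta> powr - box_dim A"
    using box_count_bounds[OF assms(6,7)] .
  then show ?thesis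
    using cover_time_measurable[OF bounded_scaling[OF assms(4)]]
      cover_time_finite[OF bounded_scaling[OF assms(4)]] tight_cover_time[OF assms(4)]
    by blast
qed

end
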